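(* Let $n,t,\kappa$ be positive integers with $\kappa t\le n$. Every $(t,\kappa)$-doped fermionic Gaussian unitary $U_t$ on $n$ qubits can be expressed as $$U_t=G_A\,(u_t\otimes I)\,G_B,$$ where $G_A,G_B$ are Gaussian unitaries on $n$ qubits and $u_t$ is a unitary supported exclusively on (the first) $\lceil \kappa t/2\rceil$ qubits.
   Context: On $n$ qubits with Pauli operators $X_k,Y_k,Z_k$, the Majorana operators are $\gamma_{2k-1}:=(\prod_{j=1}^{k-1}Z_j)X_k$ and $\gamma_{2k}:=(\prod_{j=1}^{k-1}Z_j)Y_k$, $k\in[n]:=\{1,\dots,n\}$. A (fermionic) Gaussian unitary is a unitary $G$ for which there is an orthogonal matrix $O\in\mathrm{O}(2n)$ with $G^\dagger\gamma_\mu G=\sum_{\nu=1}^{2n}O_{\mu,\nu}\gamma_\nu$ for all $\mu\in[2n]$. A $\kappa$-local gate is a unitary generated by at most $\kappa$ distinct Majorana operators, i.e. a unitary of the form $e^{iH}$ with $H$ a Hermitian operator in the algebra generated by $\kappa$ fixed Majorana operators (which operators are used may differ from gate to gate; the gate need not be Gaussian). A $(t,\kappa)$-doped Gaussian unitary is a unitary of the form $U_t=G_tW_t\cdots G_1W_1G_0$ with $G_0,\dots,G_t$ Gaussian unitaries and $W_1,\dots,W_t$ $\kappa$-local gates. *)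

theory Defs
  imports Complex_Main "Jordan_Normal_Form.Matrix" "Jordan_Normal_Form.Schur_Decomposition"
begin

text \<open>Operators on \<open>n\<close> qubits are \<open>2 ^ n \<times> 2 ^ n\<close> complex matrices in the computational basis,
  the first qubit being the leftmost tensor factor (the most significant bit of the basis index).\<close>

definition unitary_mat :: "nat \<Rightarrow> complex mat \<Rightarrow> bool" where
  "unitary_mat d U \<longleftrightarrow> U \<in> carrier_mat d d \<and>
     mat_adjoint U * U = 1\<^sub>m d \<and> U * mat_adjoint U = 1\<^sub>m d"

definition hermitian_mat :: "complex mat \<Rightarrow> bool" where
  "hermitian_mat H \<longleftrightarrow> mat_adjoint H = H"

text \<open>The library predicate \<^const>\<open>orthogonal_mat\<close> only demands pairwise orthogonal non-zero
  columns, not an orthonormal system, so the group \<open>O(d)\<close> is defined here.\<close>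

definition real_orthogonal_mat :: "nat \<Rightarrow> real mat \<Rightarrow> bool" where
  "real_orthogonal_mat d Q \<longleftrightarrow> Q \<in> carrier_mat d d \<and>
     transpose_mat Q * Q = 1\<^sub>m d \<and> Q * transpose_mat Q = 1\<^sub>m d"

definition kron :: "complex mat \<Rightarrow> complex mat \<Rightarrow> complex mat" where
  "kron A B = mat (dim_row A * dim_row B) (dim_col A * dim_col B)
     (\<lambda>(i, j). A $$ (i div dim_row B, j div dim_col B) * B $$ (i mod dim_row B, j mod dim_col B))"

text \<open>The exponential series is summed entrywise; \<open>summable_mat_exp\<close> below shows that every
  entry converges.\<close>

definition mat_exp :: "complex mat \<Rightarrow> complex mat" where
  "mat_exp A = mat (dim_row A) (dim_row A) (\<lambda>(i, j). \<Sum>k. (A ^\<^sub>m k) $$ (i, j) / fact k)"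

definition pauli_X :: "complex mat" where
  "pauli_X = mat_of_rows_list 2 [[0, 1], [1, 0]]"

definition pauli_Y :: "complex mat" where
  "pauli_Y = mat_of_rows_list 2 [[0, - \<i>], [\<i>, 0]]"

definition pauli_Z :: "complex mat" where
  "pauli_Z = mat_of_rows_list 2 [[1, 0], [0, - 1]]"

text \<open>\<open>on_qubit n k P\<close> is the one-qubit operator \<open>P\<close> acting on qubit \<open>k \<in> {1..n}\<close>.\<close>

definition on_qubit :: "nat \<Rightarrow> nat \<Rightarrow> complex mat \<Rightarrow> complex mat" where
  "on_qubit n k P = kron (kron (1\<^sub>m (2 ^ (k - 1))) P) (1\<^sub>m (2 ^ (n - k)))"

text \<open>\<open>Z_string n m = Z\<^sub>1 \<dots> Z\<^sub>m\<close>.\<close>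

primrec Z_string :: "nat \<Rightarrow> nat \<Rightarrow> complex mat" where
  "Z_string n 0 = 1\<^sub>m (2 ^ n)"
| "Z_string n (Suc m) = Z_string n m * on_qubit n (Suc m) pauli_Z"

text \<open>The index \<open>\<mu> \<in> {1..2 * n}\<close> is \<open>2 * k - 1\<close> or \<open>2 * k\<close> with \<open>k = (\<mu> + 1) div 2\<close>.\<close>

definition majorana :: "nat \<Rightarrow> nat \<Rightarrow> complex mat" where
  "majorana n \<mu> = (let k = (\<mu> + 1) div 2 in
     Z_string n (k - 1) * on_qubit n k (if odd \<mu> then pauli_X else pauli_Y))"

definition majorana_lincomb :: "nat \<Rightarrow> (nat \<Rightarrow> real) \<Rightarrow> complex mat" where
  "majorana_lincomb n c =
     mat (2 ^ n) (2 ^ n) (\<lambda>(i, j). \<Sum>\<nu> = 1..2 * n. complex_of_real (c \<nu>) * majorana n \<nu> $$ (i, j))"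

text \<open>Matrix entries are indexed from \<open>0\<close>, Majorana operators from \<open>1\<close>.\<close>

definition gaussian_unitary :: "nat \<Rightarrow> complex mat \<Rightarrow> bool" where
  "gaussian_unitary n G \<longleftrightarrow> unitary_mat (2 ^ n) G \<and>
     (\<exists>Q. real_orthogonal_mat (2 * n) Q \<and>
        (\<forall>\<mu> \<in> {1..2 * n}. mat_adjoint G * majorana n \<mu> * G =
           majorana_lincomb n (\<lambda>\<nu>. Q $$ (\<mu> - 1, \<nu> - 1))))"

text \<open>The unital complex algebra generated by the Majorana operators with indices in \<open>S\<close>.\<close>

inductive_set majorana_algebra :: "nat \<Rightarrow> nat set \<Rightarrow> complex mat set" for n S where
  one: "1\<^sub>m (2 ^ n) \<in> majorana_algebra n S"
| gen: "\<mu> \<in> S \<Longrightarrow> majorana n \<mu> \<in> majorana_algebra n S"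
| add: "A \<in> majorana_algebra n S \<Longrightarrow> B \<in> majorana_algebra n S \<Longrightarrow> A + B \<in> majorana_algebra n S"
| smult: "A \<in> majorana_algebra n S \<Longrightarrow> c \<cdot>\<^sub>m A \<in> majorana_algebra n S"
| mult: "A \<in> majorana_algebra n S \<Longrightarrow> B \<in> majorana_algebra n S \<Longrightarrow> A * B \<in> majorana_algebra n S"

definition local_gate :: "nat \<Rightarrow> nat \<Rightarrow> complex mat \<Rightarrow> bool" where
  "local_gate n \<kappa> W \<longleftrightarrow> unitary_mat (2 ^ n) W \<and>
     (\<exists>S H. S \<subseteq> {1..2 * n} \<and> card S \<le> \<kappa> \<and> H \<in> majorana_algebra n S \<and>
        hermitian_mat H \<and> W = mat_exp (\<i> \<cdot>\<^sub>m H))"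

text \<open>\<open>doped_product G W t = G\<^sub>t W\<^sub>t \<dots> G\<^sub>1 W\<^sub>1 G\<^sub>0\<close>; the value \<open>W 0\<close> is not used.\<close>

primrec doped_product :: "(nat \<Rightarrow> complex mat) \<Rightarrow> (nat \<Rightarrow> complex mat) \<Rightarrow> nat \<Rightarrow> complex mat" where
  "doped_product G W 0 = G 0"
| "doped_product G W (Suc s) = G (Suc s) * W (Suc s) * doped_product G W s"

definition doped_gaussian_unitary :: "nat \<Rightarrow> nat \<Rightarrow> nat \<Rightarrow> complex mat \<Rightarrow> bool" where
  "doped_gaussian_unitary n t \<kappa> U \<longleftrightarrow>
     (\<exists>G W. (\<forall>i \<in> {0..t}. gaussian_unitary n (G i)) \<and> (\<forall>i \<in> {1..t}. local_gate n \<kappa> (W i)) \<and>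
        U = doped_product G W t)"

lemma norm_pow_mat_entry_le:
  fixes A :: "complex mat"
  assumes A: "A \<in> carrier_mat d d"
    and M: "\<And>i j. i < d \<Longrightarrow> j < d \<Longrightarrow> norm (A $$ (i, j)) \<le> M" and "1 \<le> M"
    and "i < d" "j < d"
  shows "norm ((A ^\<^sub>m k) $$ (i, j)) \<le> (real d * M) ^ k"
  using \<open>j < d\<close>
proof (induction k arbitrary: j)
  case 0
  then show ?case using A \<open>i < d\<close> by auto
next
  case (Suc k)
  have Ak: "A ^\<^sub>m k \<in> carrier_mat d d" using A by simp
  have "(A ^\<^sub>m Suc k) $$ (i, j) = (\<Sum>l = 0..<d. (A ^\<^sub>m k) $$ (i, l) * A $$ (l, j))"
    using A Ak \<open>i < d\<close> Suc.prems by (auto simp: scalar_prod_def intro!: sum.cong)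
  also have "norm \<dots> \<le> (\<Sum>l = 0..<d. norm ((A ^\<^sub>m k) $$ (i, l)) * norm (A $$ (l, j)))"
    by (rule order_trans[OF norm_sum]) (simp add: norm_mult)
  also have "\<dots> \<le> (\<Sum>l = 0..<d. (real d * M) ^ k * M)"
    using Suc M \<open>1 \<le> M\<close> by (intro sum_mono mult_mono) auto
  also have "\<dots> = (real d * M) ^ Suc k" by simp
  finally show ?case .
qed

lemma summable_mat_exp:
  fixes A :: "complex mat"
  assumes A: "A \<in> carrier_mat d d" and "i < d" "j < d"
  shows "summable (\<lambda>k. (A ^\<^sub>m k) $$ (i, j) / fact k)"
proof -
  define S where "S = insert 1 ((\<lambda>p. norm (A $$ p)) ` ({..<d} \<times> {..<d}))"
  have fin: "finite S" unfolding S_def by simp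
  have M: "norm (A $$ (i, j)) \<le> Max S" if "i < d" "j < d" for i j
    using that by (intro Max_ge fin) (auto simp: S_def)
  have one: "1 \<le> Max S" by (intro Max_ge fin) (simp add: S_def)
  have bnd: "norm ((A ^\<^sub>m k) $$ (i, j) / fact k) \<le> inverse (fact k) * (real d * Max S) ^ k" for k
    using norm_pow_mat_entry_le[OF A M one \<open>i < d\<close> \<open>j < d\<close>, of k]
    by (simp add: norm_divide divide_simps)
  show ?thesis
    by (rule summable_comparison_test'[OF summable_exp[of "real d * Max S"], of 0]) (rule bnd)
qed

end

theory Submission
  imports Defs
begin

text \<open>For a real unit vector \<open>u\<close> the operator \<open>c(u) = \<Sum>\<nu>. u \<nu> \<gamma>\<^sub>\<nu>\<close> is itself a Gaussian unitary, acting on the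
  Majorana operators as a reflection up to sign. Householder reduction therefore yields a Gaussian unitary
  rotating any \<open>N \<le> 2 * n\<close> linear combinations of Majorana operators into the span of
  \<open>\<gamma>\<^sub>1, \<dots>, \<gamma>\<^sub>N\<close>. In a doped unitary, pushing all Gaussian factors to the right leaves gates generated by
  at most \<open>\<kappa> * t\<close> such combinations; after the rotation their product commutes with every operator \<open>I \<otimes> P\<close>
  on the last qubits, hence has the form \<open>u \<otimes> I\<close>. Working with commutants needs no more about a gate
  \<open>exp (\<i> H)\<close> than that it commutes with whatever commutes with \<open>H\<close>.\<close>

subsection \<open>Adjoints and unitaries\<close>

text \<open>The last qubits are tested with all operators \<open>I \<otimes> P\<close> and not with
  the remaining Majorana operators: a gate may contain odd products, and these anticommute with the
  Majorana operators left over, so a commutant phrased with the latter would carry parity signs. The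
  first 2m Majorana operators, in contrast, live entirely on qubits 1 to m and commute with every
  \<open>I \<otimes> P\<close> without any sign. Each qubit carries two Majorana operators, so
  \<kappa> t combinations fit on \<lceil>\<kappa> t / 2\<rceil> qubits; this is where the number
  comes from. Single vectors u suffice as building blocks because Gaussian unitaries may realise all
  of O(2n): conjugation by c(u) acts as 2 u u^T - 1, of determinant -1, and no quadratic Hamiltonian
  has to be exponentiated. The sign against a true reflection is harmless, as only the supports of
  coefficient vectors count.\<close>

lemma mat_adjoint_carrier [simp]:
  "A \<in> carrier_mat m n \<Longrightarrow> mat_adjoint A \<in> carrier_mat n m"
  by (auto simp: mat_adjoint_def)

lemma mat_adjoint_dim [simp]:
  "dim_row (mat_adjoint A) = dim_col A" "dim_col (mat_adjoint A) = dim_row A"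
  by (auto simp: mat_adjoint_def)

lemma mat_adjoint_index:
  fixes A :: "complex mat"
  assumes "i < dim_col A" "j < dim_row A"
  shows "mat_adjoint A $$ (i, j) = cnj (A $$ (j, i))"
  using assms by (simp add: mat_adjoint_def mat_of_rows_index)

lemma index_mult_mat_sum:
  assumes "A \<in> carrier_mat m n" "B \<in> carrier_mat n p" "i < m" "j < p"
  shows "(A * B) $$ (i, j) = (\<Sum>l = 0..<n. A $$ (i, l) * B $$ (l, j))"
  using assms by (auto simp: scalar_prod_def)

lemma square_mult_carrier [simp]:
  "A \<in> carrier_mat d d \<Longrightarrow> B \<in> carrier_mat d d \<Longrightarrow> A * B \<in> carrier_mat d d"
  by simp

lemma mat_adjoint_mult:
  fixes A B :: "complex mat"
  assumes "A \<in> carrier_mat m n" "B \<in> carrier_mat n p"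
  shows "mat_adjoint (A * B) = mat_adjoint B * mat_adjoint A"
  using assms
  by (intro eq_matI) (auto simp: mat_adjoint_index scalar_prod_def mult.commute intro!: sum.cong)

lemma mat_adjoint_adjoint [simp]: "mat_adjoint (mat_adjoint A) = (A :: complex mat)"
  by (intro eq_matI) (auto simp: mat_adjoint_index)

lemma mat_adjoint_one [simp]: "mat_adjoint (1\<^sub>m d) = (1\<^sub>m d :: complex mat)"
  by (intro eq_matI) (auto simp: mat_adjoint_index)

lemma unitary_mat_carrier: "unitary_mat d U \<Longrightarrow> U \<in> carrier_mat d d"
  by (simp add: unitary_mat_def)

lemma unitary_mat_one: "unitary_mat d (1\<^sub>m d)"
  by (simp add: unitary_mat_def)

lemma unitary_mat_adjoint: "unitary_mat d U \<Longrightarrow> unitary_mat d (mat_adjoint U)"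
  by (simp add: unitary_mat_def)

text \<open>Products are normalised with all brackets to the right, so an inverse pair appears in
  front of a remaining factor; this rule cancels it in that shape.\<close>

lemma mat_cancel_middle:
  fixes A :: "complex mat"
  assumes "A \<in> carrier_mat d d" "B \<in> carrier_mat d d" "C \<in> carrier_mat d d" "B * C = 1\<^sub>m d"
  shows "B * (C * A) = A"
  using assms by (metis assoc_mult_mat left_mult_one_mat)

lemma unitary_mat_mult:
  assumes "unitary_mat d U" "unitary_mat d V"
  shows "unitary_mat d (U * V)"
proof -
  have c: "U \<in> carrier_mat d d" "V \<in> carrier_mat d d"
    and a: "mat_adjoint U \<in> carrier_mat d d" "mat_adjoint V \<in> carrier_mat d d"
    and u: "mat_adjoint U * U = 1\<^sub>m d" "U * mat_adjoint U = 1\<^sub>m d"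
    and v: "mat_adjoint V * V = 1\<^sub>m d" "V * mat_adjoint V = 1\<^sub>m d"
    using assms by (auto simp: unitary_mat_def)
  have "mat_adjoint V * (mat_adjoint U * (U * V)) = 1\<^sub>m d"
    using mat_cancel_middle[OF c(2) a(1) c(1) u(1)] v by simp
  moreover have "U * (V * (mat_adjoint V * mat_adjoint U)) = 1\<^sub>m d"
    using mat_cancel_middle[OF a(1) c(2) a(2) v(2)] u by simp
  ultimately show ?thesis
    using c a by (simp add: unitary_mat_def mat_adjoint_mult[OF c] assoc_mult_mat[of _ d d _ d _ d])
qed

lemma unitary_conj_mult:
  assumes "unitary_mat d U" "A \<in> carrier_mat d d" "B \<in> carrier_mat d d"
  shows "(mat_adjoint U * A * U) * (mat_adjoint U * B * U) = mat_adjoint U * (A * B) * U"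
proof -
  have c: "U \<in> carrier_mat d d" "mat_adjoint U \<in> carrier_mat d d" "U * mat_adjoint U = 1\<^sub>m d"
    using assms by (auto simp: unitary_mat_def)
  have "U * (mat_adjoint U * (B * U)) = B * U"
    using mat_cancel_middle[of "B * U" d U "mat_adjoint U"] c assms by simp
  then show ?thesis using c assms by (simp add: assoc_mult_mat[of _ d d _ d _ d])
qed

lemma unitary_conj_cancel:
  assumes "unitary_mat d U" "A \<in> carrier_mat d d"
  shows "U * (mat_adjoint U * A * U) * mat_adjoint U = A"
    and "mat_adjoint U * (U * A * mat_adjoint U) * U = A"
proof -
  have c: "U \<in> carrier_mat d d" "mat_adjoint U \<in> carrier_mat d d"
    and u: "U * mat_adjoint U = 1\<^sub>m d" "mat_adjoint U * U = 1\<^sub>m d"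
    using assms by (auto simp: unitary_mat_def)
  have e: "U * (mat_adjoint U * A * U) * mat_adjoint U = U * (mat_adjoint U * (A * (U * mat_adjoint U)))"
    "mat_adjoint U * (U * A * mat_adjoint U) * U = mat_adjoint U * (U * (A * (mat_adjoint U * U)))"
    using c assms(2) by (simp_all add: assoc_mult_mat[of _ d d _ d _ d])
  show "U * (mat_adjoint U * A * U) * mat_adjoint U = A"
    "mat_adjoint U * (U * A * mat_adjoint U) * U = A"
    by (simp_all only: e u right_mult_one_mat[OF assms(2)]
        mat_cancel_middle[OF assms(2) c u(1)] mat_cancel_middle[OF assms(2) c(2,1) u(2)])
qed

section \<open>Commutation and its transport under conjugation\<close>

definition mat_commute :: "'a :: semiring_0 mat \<Rightarrow> 'a mat \<Rightarrow> bool" where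
  "mat_commute A B \<longleftrightarrow> A * B = B * A"

lemma mat_commute_mult:
  assumes c: "A \<in> carrier_mat d d" "B \<in> carrier_mat d d" "C \<in> carrier_mat d d"
    and "mat_commute A C" "mat_commute B C"
  shows "mat_commute (A * B) C"
proof -
  have "A * C = C * A" "B * C = C * B" using assms by (simp_all add: mat_commute_def)
  then show ?thesis
    unfolding mat_commute_def
    using assoc_mult_mat[OF c] assoc_mult_mat[OF c(1,3,2)] assoc_mult_mat[OF c(3,1,2)] by metis
qed

lemma mat_commute_conj:
  assumes U: "unitary_mat d U" and "A \<in> carrier_mat d d" "B \<in> carrier_mat d d"
  shows "mat_commute (mat_adjoint U * A * U) (mat_adjoint U * B * U) \<longleftrightarrow> mat_commute A B"
proof
  assume "mat_commute A B"
  then show "mat_commute (mat_adjoint U * A * U) (mat_adjoint U * B * U)"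
    using assms by (simp add: mat_commute_def unitary_conj_mult)
next
  assume "mat_commute (mat_adjoint U * A * U) (mat_adjoint U * B * U)"
  then have "U * (mat_adjoint U * (A * B) * U) * mat_adjoint U =
      U * (mat_adjoint U * (B * A) * U) * mat_adjoint U"
    using assms by (simp add: mat_commute_def unitary_conj_mult)
  then show "mat_commute A B"
    using assms by (simp add: mat_commute_def unitary_conj_cancel)
qed

text \<open>Trades a rotation of a generator for the inverse rotation of the test operator; this is
  how commutants are carried through Gaussian factors.\<close>

lemma mat_commute_conj_shift:
  assumes U: "unitary_mat d U" and "A \<in> carrier_mat d d" "B \<in> carrier_mat d d"
  shows "mat_commute (U * A * mat_adjoint U) B \<longleftrightarrow> mat_commute A (mat_adjoint U * B * U)"
proof -
  have "U \<in> carrier_mat d d" using U by (rule unitary_mat_carrier)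
  then have "U * A * mat_adjoint U \<in> carrier_mat d d" using assms by simp
  from mat_commute_conj[OF U this assms(3)] show ?thesis
    using assms by (simp add: unitary_conj_cancel)
qed

subsection \<open>The exponential series\<close>

lemma mat_commute_pow:
  fixes A :: "complex mat"
  assumes "A \<in> carrier_mat d d" "B \<in> carrier_mat d d" "mat_commute A B"
  shows "mat_commute (A ^\<^sub>m k) B"
  using assms
proof (induction k)
  case 0
  then show ?case by (simp add: mat_commute_def)
next
  case (Suc k)
  then show ?case using mat_commute_mult[of "A ^\<^sub>m k" d A B] by simp
qed

text \<open>All powers of A commute with B. Each entry of a product is a finite sum, so it may be
  exchanged with the series once every entry converges, which is
  \<open>summable_mat_exp\<close>.\<close>

lemma mat_commute_exp:
  fixes A :: "complex mat"
  assumes A: "A \<in> carrier_mat d d" and B: "B \<in> carrier_mat d d" and AB: "mat_commute A B"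
  shows "mat_commute (mat_exp A) B"
proof -
  have E: "mat_exp A \<in> carrier_mat d d" using A by (simp add: mat_exp_def)
  have idx: "mat_exp A $$ (i, j) = (\<Sum>k. (A ^\<^sub>m k) $$ (i, j) / fact k)"
    if "i < d" "j < d" for i j
    using A that by (simp add: mat_exp_def)
  have Ak: "A ^\<^sub>m k \<in> carrier_mat d d" for k using A by simp
  have "mat_exp A * B = B * mat_exp A"
  proof (rule eq_matI)
    fix i j assume "i < dim_row (B * mat_exp A)" "j < dim_col (B * mat_exp A)"
    then have ij: "i < d" "j < d" using B E by auto
    note sm = summable_mat_exp[OF A]
    have "(mat_exp A * B) $$ (i, j) = (\<Sum>l = 0..<d. (\<Sum>k. (A ^\<^sub>m k) $$ (i, l) / fact k) * B $$ (l, j))"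
      using E B ij by (auto simp: scalar_prod_def idx intro!: sum.cong)
    also have "\<dots> = (\<Sum>l = 0..<d. \<Sum>k. (A ^\<^sub>m k) $$ (i, l) / fact k * B $$ (l, j))"
      using ij by (intro sum.cong refl suminf_mult2 sm) auto
    also have "\<dots> = (\<Sum>k. \<Sum>l = 0..<d. (A ^\<^sub>m k) $$ (i, l) / fact k * B $$ (l, j))"
      using ij by (intro suminf_sum [symmetric] summable_mult2 sm) auto
    also have "\<dots> = (\<Sum>k. (A ^\<^sub>m k * B) $$ (i, j) / fact k)"
      by (simp add: index_mult_mat_sum[OF Ak B ij] sum_divide_distrib)
    also have "\<dots> = (\<Sum>k. (B * A ^\<^sub>m k) $$ (i, j) / fact k)"
      using mat_commute_pow[OF A B AB] by (simp add: mat_commute_def)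
    also have "\<dots> = (\<Sum>k. \<Sum>l = 0..<d. B $$ (i, l) * ((A ^\<^sub>m k) $$ (l, j) / fact k))"
      by (simp add: index_mult_mat_sum[OF B Ak ij] sum_divide_distrib)
    also have "\<dots> = (\<Sum>l = 0..<d. \<Sum>k. B $$ (i, l) * ((A ^\<^sub>m k) $$ (l, j) / fact k))"
      using ij by (intro suminf_sum summable_mult sm) auto
    also have "\<dots> = (\<Sum>l = 0..<d. B $$ (i, l) * (\<Sum>k. (A ^\<^sub>m k) $$ (l, j) / fact k))"
      using ij by (intro sum.cong refl suminf_mult sm) auto
    also have "\<dots> = (B * mat_exp A) $$ (i, j)"
      using E B ij by (auto simp: scalar_prod_def idx intro!: sum.cong)
    finally show "(mat_exp A * B) $$ (i, j) = (B * mat_exp A) $$ (i, j)" .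
  qed (use E B in auto)
  then show ?thesis by (simp add: mat_commute_def)
qed

subsection \<open>Kronecker products\<close>

lemma kron_carrier [simp]:
  "A \<in> carrier_mat a b \<Longrightarrow> B \<in> carrier_mat c d \<Longrightarrow> kron A B \<in> carrier_mat (a * c) (b * d)"
  by (auto simp: kron_def)

lemma kron_dim [simp]:
  "dim_row (kron A B) = dim_row A * dim_row B" "dim_col (kron A B) = dim_col A * dim_col B"
  by (auto simp: kron_def)

lemma kron_index:
  "i < dim_row A * dim_row B \<Longrightarrow> j < dim_col A * dim_col B \<Longrightarrow> kron A B $$ (i, j) =
    A $$ (i div dim_row B, j div dim_col B) * B $$ (i mod dim_row B, j mod dim_col B)"
  by (simp add: kron_def)

lemma div_mod_bounds:
  fixes i a b :: nat
  assumes "i < a * b"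
  shows "i div b < a" "i mod b < b"
  using assms less_mult_imp_div_less by (auto, metis gr0I mod_less_divisor mult_is_0 not_less0)

lemma index_bound:
  fixes i a r b :: nat
  assumes "i < a" "r < b"
  shows "i * b + r < a * b"
proof -
  have "i * b + r < Suc i * b" using assms by simp
  also have "\<dots> \<le> a * b" using assms by (intro mult_right_mono) auto
  finally show ?thesis .
qed

text \<open>Quotient and remainder of l run exactly once through the rectangle of index pairs; this
  splits the entries in \<open>kron_mult\<close>.\<close>

lemma sum_div_mod:
  fixes f g :: "nat \<Rightarrow> 'a :: comm_semiring_0"
  shows "(\<Sum>l = 0..<a * b. f (l div b) * g (l mod b)) = (\<Sum>l = 0..<a. f l) * (\<Sum>l = 0..<b. g l)"
proof -
  have "(\<Sum>l = 0..<a * b. f (l div b) * g (l mod b)) =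
      (\<Sum>(i, j) \<in> {0..<a} \<times> {0..<b}. f i * g j)"
    by (rule sum.reindex_bij_witness[of _ "\<lambda>(i, j). i * b + j" "\<lambda>l. (l div b, l mod b)"])
      (auto simp: div_mod_bounds index_bound)
  then show ?thesis by (simp add: sum_product sum.cartesian_product)
qed

lemma kron_mult:
  assumes "A \<in> carrier_mat a b" "C \<in> carrier_mat b c" "B \<in> carrier_mat p q" "D \<in> carrier_mat q r"
  shows "kron A B * kron C D = kron (A * C) (B * D)"
proof (rule eq_matI)
  fix i j assume "i < dim_row (kron (A * C) (B * D))" "j < dim_col (kron (A * C) (B * D))"
  then have ij: "i < a * p" "j < c * r" using assms by auto
  note bd = div_mod_bounds[OF ij(1)] div_mod_bounds[OF ij(2)]
  have "(kron A B * kron C D) $$ (i, j) =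
      (\<Sum>l = 0..<b * q. (A $$ (i div p, l div q) * C $$ (l div q, j div r)) *
                        (B $$ (i mod p, l mod q) * D $$ (l mod q, j mod r)))"
    using assms ij by (auto simp: scalar_prod_def kron_index intro!: sum.cong)
  also have "\<dots> = (\<Sum>l = 0..<b. A $$ (i div p, l) * C $$ (l, j div r)) *
                  (\<Sum>l = 0..<q. B $$ (i mod p, l) * D $$ (l, j mod r))"
    by (rule sum_div_mod)
  also have "\<dots> = kron (A * C) (B * D) $$ (i, j)"
    using assms ij bd by (simp add: kron_index scalar_prod_def)
  finally show "(kron A B * kron C D) $$ (i, j) = kron (A * C) (B * D) $$ (i, j)" .
qed (use assms in auto)

lemma kron_assoc: "kron (kron A B) C = kron A (kron B C)"
proof (rule eq_matI)
  \<comment> \<open>Last and middle digit of a three-place mixed-radix index: both bracketings of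
    the triple product read the same digits.\<close>
  have md: "(i mod (n * m)) mod n = i mod n" "(i mod (n * m)) div n = (i div n) mod m"
    for i m n :: nat
    unfolding mod_mult2_eq by (cases "n = 0"; simp)+
  fix i j assume ij: "i < dim_row (kron A (kron B C))" "j < dim_col (kron A (kron B C))"
  note bd = div_mod_bounds[of i "dim_row A" "dim_row B * dim_row C"]
    div_mod_bounds[of i "dim_row A * dim_row B" "dim_row C"]
    div_mod_bounds[of j "dim_col A" "dim_col B * dim_col C"]
    div_mod_bounds[of j "dim_col A * dim_col B" "dim_col C"]
  show "kron (kron A B) C $$ (i, j) = kron A (kron B C) $$ (i, j)"
    using ij bd by (simp add: kron_index md div_mult2_eq[symmetric] mult.assoc mult.commute[of "dim_row B"] mult.commute[of "dim_col B"])
qed auto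

lemma kron_one_one: "kron (1\<^sub>m a) (1\<^sub>m b) = 1\<^sub>m (a * b)"
proof (rule eq_matI)
  fix i j assume "i < dim_row (1\<^sub>m (a * b) :: complex mat)" "j < dim_col (1\<^sub>m (a * b) :: complex mat)"
  then have ij: "i < a * b" "j < a * b" by auto
  have "i = j \<longleftrightarrow> i div b = j div b \<and> i mod b = j mod b" by (metis div_mult_mod_eq)
  then show "kron (1\<^sub>m a) (1\<^sub>m b) $$ (i, j) = 1\<^sub>m (a * b) $$ (i, j)"
    using ij div_mod_bounds[OF ij(1)] div_mod_bounds[OF ij(2)] by (auto simp: kron_index)
qed auto

lemma kron_one_left: "kron (1\<^sub>m 1) A = A"
  by (rule eq_matI) (auto simp: kron_index)

lemma kron_uminus:
  "kron (- A) B = - kron A B" "kron A (- B) = - kron A B"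
proof (rule_tac [!] eq_matI)
  fix i j assume "i < dim_row (- kron A B)" "j < dim_col (- kron A B)"
  then have ij: "i < dim_row A * dim_row B" "j < dim_col A * dim_col B" by auto
  note bd = div_mod_bounds[OF ij(1)] div_mod_bounds[OF ij(2)]
  show "kron (- A) B $$ (i, j) = (- kron A B) $$ (i, j)"
    "kron A (- B) $$ (i, j) = (- kron A B) $$ (i, j)"
    using ij bd by (simp_all add: kron_index)
qed auto

lemma mat_adjoint_kron: "mat_adjoint (kron A B) = kron (mat_adjoint A) (mat_adjoint B)"
proof (rule eq_matI)
  fix i j assume "i < dim_row (kron (mat_adjoint A) (mat_adjoint B))"
    "j < dim_col (kron (mat_adjoint A) (mat_adjoint B))"
  then have ij: "i < dim_col A * dim_col B" "j < dim_row A * dim_row B" by auto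
  show "mat_adjoint (kron A B) $$ (i, j) = kron (mat_adjoint A) (mat_adjoint B) $$ (i, j)"
    using ij div_mod_bounds[OF ij(1)] div_mod_bounds[OF ij(2)]
    by (simp add: kron_index mat_adjoint_index)
qed auto

section \<open>Recovering a left tensor factor\<close>

lemma kron_one_inject:
  assumes "A \<in> carrier_mat d d" "B \<in> carrier_mat d d" "0 < e"
    "kron A (1\<^sub>m e) = kron B (1\<^sub>m e)"
  shows "A = B"
proof (rule eq_matI)
  fix i j assume "i < dim_row B" "j < dim_col B"
  then have ij: "i < d" "j < d" using assms by auto
  \<comment> \<open>At this index pair the second factor contributes its entry (0, 0), which is
    1.\<close>
  have b: "i * e < d * e" "j * e < d * e" using ij \<open>0 < e\<close> by auto
  have "kron A (1\<^sub>m e) $$ (i * e, j * e) = kron B (1\<^sub>m e) $$ (i * e, j * e)"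
    using assms by simp
  then show "A $$ (i, j) = B $$ (i, j)"
    using assms(1-3) b by (simp add: kron_index)
qed (use assms in auto)

text \<open>Tensoring with the identity is multiplicative, respects adjoints and is injective, so
  the two unitarity equations descend to u.\<close>

lemma unitary_mat_kron_one:
  assumes "unitary_mat (d * e) (kron u (1\<^sub>m e))" "u \<in> carrier_mat d d" "0 < e"
  shows "unitary_mat d u"
proof -
  have c: "mat_adjoint u \<in> carrier_mat d d" using assms by simp
  have "kron (mat_adjoint u * u) (1\<^sub>m e) = kron (1\<^sub>m d) (1\<^sub>m e)"
    "kron (u * mat_adjoint u) (1\<^sub>m e) = kron (1\<^sub>m d) (1\<^sub>m e)"
    using assms(1) kron_mult[OF c assms(2) one_carrier_mat one_carrier_mat, of e]
      kron_mult[OF assms(2) c one_carrier_mat one_carrier_mat, of e]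
    by (simp_all add: unitary_mat_def mat_adjoint_kron kron_one_one)
  then have "mat_adjoint u * u = 1\<^sub>m d" "u * mat_adjoint u = 1\<^sub>m d"
    using kron_one_inject[OF _ one_carrier_mat \<open>0 < e\<close>, of _ d] assms(2) c by (metis mult_carrier_mat)+
  then show ?thesis using assms by (simp add: unitary_mat_def)
qed

text \<open>It suffices to test against the matrix units in the first column.\<close>

lemma commutant_of_kron_one:
  assumes M: "M \<in> carrier_mat (d * e) (d * e)" and "0 < e"
    and comm: "\<And>P. P \<in> carrier_mat e e \<Longrightarrow> mat_commute M (kron (1\<^sub>m d) P)"
  shows "\<exists>u \<in> carrier_mat d d. M = kron u (1\<^sub>m e)"
proof -
  define u where "u = mat d d (\<lambda>(i, j). M $$ (i * e, j * e))"
  \<comment> \<open>Each block (i, j) of size e is a scalar multiple of the identity, the scalar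
    being its top left entry.\<close>
  have key: "M $$ (i * e + a, j * e + r) = (if a = r then M $$ (i * e, j * e) else 0)"
    if "i < d" "j < d" "a < e" "r < e" for i j a r
  proof -
    \<comment> \<open>Matrix unit with its 1 in row r, column 0. Multiplying by
      \<open>kron 1 P\<close> on the right moves column r of each block to column 0, on the left it
      moves row 0 to row r; comparing column 0 of both products isolates a single entry of
      M.\<close>
    define P where "P = mat e e (\<lambda>(x, y). if x = r \<and> y = 0 then 1 else 0 :: complex)"
    have P: "P \<in> carrier_mat e e" by (simp add: P_def)
    have b: "i * e + a < d * e" "j * e + r < d * e" "i * e < d * e" "j * e < d * e"
      using that \<open>0 < e\<close> by (auto simp: index_bound)
    have k: "kron (1\<^sub>m d) P $$ (l, m) =
        (if l div e = m div e \<and> l mod e = r \<and> m mod e = 0 then 1 else 0)"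
      if "l < d * e" "m < d * e" for l m
      using P div_mod_bounds[OF that(1)] div_mod_bounds[OF that(2)] that
      by (auto simp: kron_index) (auto simp: P_def)
    have "(M * kron (1\<^sub>m d) P) $$ (i * e + a, j * e) =
        (\<Sum>l = 0..<d * e. M $$ (i * e + a, l) * (if l = j * e + r then 1 else 0))"
    proof -
      have "l div e = j \<and> l mod e = r \<longleftrightarrow> l = j * e + r" for l
        using that by auto
      then show ?thesis
        using M P b \<open>0 < e\<close> by (auto simp: scalar_prod_def k intro!: sum.cong)
    qed
    also have "\<dots> = M $$ (i * e + a, j * e + r)"
      using b by (simp add: if_distrib[of "(*) _"] cong: if_cong)
    finally have 1: "(M * kron (1\<^sub>m d) P) $$ (i * e + a, j * e) = M $$ (i * e + a, j * e + r)" .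
    have "(kron (1\<^sub>m d) P * M) $$ (i * e + a, j * e) =
        (\<Sum>l = 0..<d * e. (if l = i * e then if a = r then 1 else 0 else 0) * M $$ (l, j * e))"
    proof -
      have "i = l div e \<and> a = r \<and> l mod e = 0 \<longleftrightarrow> l = i * e \<and> a = r" for l
        using that by auto
      then show ?thesis
        using M P b that \<open>0 < e\<close> by (auto simp: scalar_prod_def k intro!: sum.cong)
    qed
    also have "\<dots> = (if a = r then M $$ (i * e, j * e) else 0)" 
      using b by (simp add: if_distrib[of "\<lambda>x. x * _"] cong: if_cong)
    finally show ?thesis using 1 comm[OF P] by (simp add: mat_commute_def)
  qed
  have "M = kron u (1\<^sub>m e)"
  proof (rule eq_matI)
    fix i j assume "i < dim_row (kron u (1\<^sub>m e))" "j < dim_col (kron u (1\<^sub>m e))"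
    then have ij: "i < d * e" "j < d * e" by (auto simp: u_def)
    note bd = div_mod_bounds[OF ij(1)] div_mod_bounds[OF ij(2)]
    show "M $$ (i, j) = kron u (1\<^sub>m e) $$ (i, j)"
      using key[OF bd(1) bd(3) bd(2) bd(4)] ij bd by (auto simp: kron_index u_def)
  qed (use M in \<open>auto simp: u_def\<close>)
  then show ?thesis by (auto simp: u_def)
qed

subsection \<open>Majorana operators\<close>

lemma pauli_carrier [simp]:
  "pauli_X \<in> carrier_mat 2 2" "pauli_Y \<in> carrier_mat 2 2" "pauli_Z \<in> carrier_mat 2 2"
  by (auto simp: pauli_X_def pauli_Y_def pauli_Z_def mat_of_rows_list_def)

lemma pauli_mult:
  "pauli_X * pauli_X = 1\<^sub>m 2" "pauli_Y * pauli_Y = 1\<^sub>m 2" "pauli_Z * pauli_Z = 1\<^sub>m 2"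
  "pauli_Y * pauli_X = - (pauli_X * pauli_Y)"
  "pauli_Z * pauli_X = - (pauli_X * pauli_Z)" "pauli_Z * pauli_Y = - (pauli_Y * pauli_Z)"
  by (rule eq_matI; auto simp: pauli_X_def pauli_Y_def pauli_Z_def mat_of_rows_list_def
      scalar_prod_def numeral_2_eq_2 less_Suc_eq)+

lemma pauli_adjoint:
  "mat_adjoint pauli_X = pauli_X" "mat_adjoint pauli_Y = pauli_Y" "mat_adjoint pauli_Z = pauli_Z"
  by (rule eq_matI; auto simp: mat_adjoint_index pauli_X_def pauli_Y_def pauli_Z_def
      mat_of_rows_list_def numeral_2_eq_2 less_Suc_eq)+

text \<open>The string without identity padding. As a plain tensor power it can be cut at any qubit
  by \<open>Z_power_add\<close>, whereas \<open>Z_string\<close> is a matrix product on all n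
  qubits.\<close>

primrec Z_power :: "nat \<Rightarrow> complex mat" where
  "Z_power 0 = 1\<^sub>m 1"
| "Z_power (Suc m) = kron (Z_power m) pauli_Z"

lemma Z_power_carrier [simp]: "Z_power m \<in> carrier_mat (2 ^ m) (2 ^ m)"
proof (induction m)
  case (Suc m)
  from kron_carrier[OF this pauli_carrier(3)] show ?case by (simp add: mult.commute)
qed simp

lemma Z_power_square: "Z_power m * Z_power m = 1\<^sub>m (2 ^ m)"
proof (induction m)
  case (Suc m)
  have "Z_power (Suc m) * Z_power (Suc m) = kron (Z_power m * Z_power m) (pauli_Z * pauli_Z)"
    using kron_mult[OF Z_power_carrier Z_power_carrier pauli_carrier(3) pauli_carrier(3)] by simp
  then show ?case by (simp add: Suc pauli_mult kron_one_one mult.commute)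
qed simp

lemma Z_power_adjoint: "mat_adjoint (Z_power m) = Z_power m"
  by (induction m) (simp_all add: mat_adjoint_kron pauli_adjoint)

lemma Z_power_add: "Z_power (a + b) = kron (Z_power a) (Z_power b)"
proof (induction b)
  case 0
  have "kron A (1\<^sub>m 1) = A" for A by (rule eq_matI) (auto simp: kron_index)
  then show ?case by simp
next
  case (Suc b)
  then show ?case by (simp add: kron_assoc)
qed

lemma Z_string_eq: "m \<le> n \<Longrightarrow> Z_string n m = kron (Z_power m) (1\<^sub>m (2 ^ (n - m)))"
proof (induction m)
  case 0
  then show ?case using kron_one_left[of "1\<^sub>m (2 ^ n)"] by simp
next
  case (Suc m)
  \<comment> \<open>One identity qubit is split off the padding, so that both factors have the slots
    "first m qubits, qubit m + 1, rest" and multiply slotwise.\<close>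
  have "n - m = Suc (n - Suc m)" using Suc.prems by simp
  then have split: "1\<^sub>m (2 ^ (n - m)) = kron (1\<^sub>m 2) (1\<^sub>m (2 ^ (n - Suc m)))"
    by (simp add: kron_one_one)
  have "Z_string n (Suc m) =
      kron (kron (Z_power m) (1\<^sub>m 2)) (1\<^sub>m (2 ^ (n - Suc m))) *
      kron (kron (1\<^sub>m (2 ^ m)) pauli_Z) (1\<^sub>m (2 ^ (n - Suc m)))"
    using Suc by (simp add: on_qubit_def split kron_assoc)
  also have "\<dots> = kron (kron (Z_power m * 1\<^sub>m (2 ^ m)) (1\<^sub>m 2 * pauli_Z))
      (1\<^sub>m (2 ^ (n - Suc m)) * 1\<^sub>m (2 ^ (n - Suc m)))"
    by (subst kron_mult[of _ "2 ^ m * 2" "2 ^ m * 2" _ "2 ^ m * 2"])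
      (auto simp: kron_mult[of _ "2 ^ m" "2 ^ m" _ "2 ^ m" _ 2 2 _ 2] intro!: kron_carrier)
  also have "\<dots> = kron (Z_power (Suc m)) (1\<^sub>m (2 ^ (n - Suc m)))"
    using left_mult_one_mat[OF pauli_carrier(3)] right_mult_one_mat[OF Z_power_carrier[of m]] by simp
  finally show ?case .
qed

definition local_pauli :: "nat \<Rightarrow> complex mat" where
  "local_pauli \<mu> = (if odd \<mu> then pauli_X else pauli_Y)"

lemma local_pauli:
  "local_pauli \<mu> \<in> carrier_mat 2 2" "local_pauli \<mu> * local_pauli \<mu> = 1\<^sub>m 2"
  "mat_adjoint (local_pauli \<mu>) = local_pauli \<mu>"
  "pauli_Z * local_pauli \<mu> = - (local_pauli \<mu> * pauli_Z)"
  by (auto simp: local_pauli_def pauli_mult pauli_adjoint)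

text \<open>Slotwise multiplication of the string with the Pauli operator. The facts about single
  Majorana operators below are read off from this tensor form.\<close>

lemma majorana_eq:
  assumes "1 \<le> k" "k \<le> n" "(\<mu> + 1) div 2 = k"
  shows "majorana n \<mu> = kron (kron (Z_power (k - 1)) (local_pauli \<mu>)) (1\<^sub>m (2 ^ (n - k)))"
proof -
  define m where "m = k - 1"
  have k: "k = Suc m" using assms by (simp add: m_def)
  have "n - m = Suc (n - k)" using assms k by simp
  then have split: "1\<^sub>m (2 ^ (n - m)) = kron (1\<^sub>m 2) (1\<^sub>m (2 ^ (n - k)))"
    by (simp add: kron_one_one)
  have "majorana n \<mu> = kron (kron (Z_power m) (1\<^sub>m 2)) (1\<^sub>m (2 ^ (n - k))) *
      kron (kron (1\<^sub>m (2 ^ m)) (local_pauli \<mu>)) (1\<^sub>m (2 ^ (n - k)))"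
    using assms k
    by (simp add: majorana_def Let_def Z_string_eq on_qubit_def local_pauli_def kron_assoc split)
  also have "\<dots> = kron (kron (Z_power m * 1\<^sub>m (2 ^ m)) (1\<^sub>m 2 * local_pauli \<mu>))
      (1\<^sub>m (2 ^ (n - k)) * 1\<^sub>m (2 ^ (n - k)))"
    by (subst kron_mult[of _ "2 ^ m * 2" "2 ^ m * 2" _ "2 ^ m * 2"])
      (auto simp: kron_mult[of _ "2 ^ m" "2 ^ m" _ "2 ^ m" _ 2 2 _ 2] local_pauli intro!: kron_carrier)
  also have "\<dots> = kron (kron (Z_power m) (local_pauli \<mu>)) (1\<^sub>m (2 ^ (n - k)))"
    using left_mult_one_mat[OF local_pauli(1)] right_mult_one_mat[OF Z_power_carrier[of m]] by simp
  finally show ?thesis by (simp add: m_def)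
qed

lemma majorana_mode:
  fixes \<mu> n :: nat
  assumes "\<mu> \<in> {1..2 * n}"
  obtains k where "1 \<le> k" "k \<le> n" "(\<mu> + 1) div 2 = k"
  using assms by (intro that[of "(\<mu> + 1) div 2"]) auto

text \<open>The exponents k - 1, 1 and n - k add up to n only in this range, since subtraction is
  truncated.\<close>

lemma three_factor_dims:
  assumes "1 \<le> k" "k \<le> n"
  shows "2 ^ (k - 1) * 2 * 2 ^ (n - k) = (2 :: nat) ^ n"
proof -
  have "2 ^ (k - 1) * 2 * 2 ^ (n - k) = (2 :: nat) ^ (k - 1 + 1 + (n - k))"
    by (simp only: power_add power_one_right)
  then show ?thesis using assms by simp
qed

text \<open>For \<open>\<mu> > 2 * n\<close> truncated subtraction gives \<open>majorana n \<mu>\<close> a wrong dimension.\<close>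

lemma majorana_carrier:
  assumes "\<mu> \<in> {1..2 * n}"
  shows "majorana n \<mu> \<in> carrier_mat (2 ^ n) (2 ^ n)"
proof -
  obtain k where k: "1 \<le> k" "k \<le> n" "(\<mu> + 1) div 2 = k" using assms by (rule majorana_mode)
  from kron_carrier[OF kron_carrier[OF Z_power_carrier local_pauli(1)] one_carrier_mat,
      of "k - 1" \<mu> "2 ^ (n - k)"]
  show ?thesis by (simp only: majorana_eq[OF k] three_factor_dims[OF k(1,2)])
qed

lemma majorana_adjoint:
  assumes "\<mu> \<in> {1..2 * n}"
  shows "mat_adjoint (majorana n \<mu>) = majorana n \<mu>"
proof -
  obtain k where "1 \<le> k" "k \<le> n" "(\<mu> + 1) div 2 = k" using assms by (rule majorana_mode)
  then show ?thesis by (simp add: majorana_eq mat_adjoint_kron Z_power_adjoint local_pauli)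
qed

lemma kron3_mult:
  assumes "A \<in> carrier_mat a a" "A' \<in> carrier_mat a a" "B \<in> carrier_mat b b" "B' \<in> carrier_mat b b"
    "C \<in> carrier_mat c c" "C' \<in> carrier_mat c c"
  shows "kron (kron A B) C * kron (kron A' B') C' = kron (kron (A * A') (B * B')) (C * C')"
  using kron_mult[OF kron_carrier[OF assms(1,3)] kron_carrier[OF assms(2,4)] assms(5,6)]
    kron_mult[OF assms(1-4)] by simp

lemma majorana_square:
  assumes "\<mu> \<in> {1..2 * n}"
  shows "majorana n \<mu> * majorana n \<mu> = 1\<^sub>m (2 ^ n)"
proof -
  obtain k where k: "1 \<le> k" "k \<le> n" "(\<mu> + 1) div 2 = k" using assms by (rule majorana_mode)
  show ?thesis using three_factor_dims[OF k(1,2)]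
    by (simp add: majorana_eq[OF k] kron3_mult[OF Z_power_carrier Z_power_carrier local_pauli(1)
          local_pauli(1) one_carrier_mat one_carrier_mat] Z_power_square local_pauli kron_one_one)
qed

text \<open>Let j be the qubit of the Pauli factor of the earlier operator. Left of j both carry the
  same Z string, right of j the earlier one is the identity, and on j the two factors anticommute;
  this single sign is the result.\<close>

lemma majorana_anticommute_less:
  assumes "\<mu> \<in> {1..2 * n}" "\<nu> \<in> {1..2 * n}" "\<mu> < \<nu>"
  shows "majorana n \<mu> * majorana n \<nu> = - (majorana n \<nu> * majorana n \<mu>)"
proof -
  obtain j where j: "1 \<le> j" "j \<le> n" "(\<mu> + 1) div 2 = j" using assms(1) by (rule majorana_mode)
  obtain k where k: "1 \<le> k" "k \<le> n" "(\<nu> + 1) div 2 = k" using assms(2) by (rule majorana_mode)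
  \<comment> \<open>Q is the factor of the later operator on qubit j, R its remainder to the
    right.\<close>
  have anti: ?thesis
    if eq: "majorana n \<nu> = kron (kron (Z_power (j - 1)) Q) R"
      and Q: "Q \<in> carrier_mat 2 2" "local_pauli \<mu> * Q = - (Q * local_pauli \<mu>)"
      and R: "R \<in> carrier_mat (2 ^ (n - j)) (2 ^ (n - j))" for Q R
  proof -
    note m = kron3_mult[OF Z_power_carrier Z_power_carrier local_pauli(1) Q(1) one_carrier_mat R]
      kron3_mult[OF Z_power_carrier Z_power_carrier Q(1) local_pauli(1) R one_carrier_mat]
    show ?thesis
      by (simp only: majorana_eq[OF j] eq m Q(2) kron_uminus left_mult_one_mat[OF R]
          right_mult_one_mat[OF R])
  qed
  show ?thesis
  proof (cases "j = k")
    case True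
    \<comment> \<open>On a common qubit the order of the indices leaves only the pair X, Y.\<close>
    then have "\<nu> = 2 * j" "\<mu> = 2 * j - 1" using j k \<open>\<mu> < \<nu>\<close> by presburger+
    then have "local_pauli \<nu> = pauli_Y" "local_pauli \<mu> = pauli_X"
      using j by (auto simp: local_pauli_def)
    then have "local_pauli \<mu> * local_pauli \<nu> = - (local_pauli \<nu> * local_pauli \<mu>)"
      by (simp add: pauli_mult)
    with anti[OF _ local_pauli(1), of \<nu> "1\<^sub>m (2 ^ (n - j))"] True show ?thesis
      by (simp add: majorana_eq[OF k])
  next
    case False
    then have "j < k" using j k \<open>\<mu> < \<nu>\<close> by auto
    define R where "R = kron (kron (Z_power (k - 1 - j)) (local_pauli \<nu>)) (1\<^sub>m (2 ^ (n - k)))"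
    \<comment> \<open>The Z string of the later operator is cut into the part before qubit j, the
      single Z on j that meets the Pauli factor of the earlier operator, and the part after
      j.\<close>
    have "k - 1 = (j - 1) + (1 + (k - 1 - j))" using \<open>j < k\<close> j by simp
    then have "Z_power (k - 1) = kron (Z_power (j - 1)) (kron (Z_power 1) (Z_power (k - 1 - j)))"
      by (metis Z_power_add)
    then have eq: "majorana n \<nu> = kron (kron (Z_power (j - 1)) pauli_Z) R"
      using kron_one_left by (simp add: majorana_eq[OF k] R_def kron_assoc)
    have "2 ^ (k - 1 - j) * 2 * 2 ^ (n - k) = (2 :: nat) ^ (n - j)"
      using three_factor_dims[of "k - j" "n - j"] \<open>j < k\<close> k by simp
    moreover have "R \<in> carrier_mat (2 ^ (k - 1 - j) * 2 * 2 ^ (n - k)) (2 ^ (k - 1 - j) * 2 * 2 ^ (n - k))"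
      unfolding R_def by (intro kron_carrier) (auto simp: local_pauli)
    ultimately have R: "R \<in> carrier_mat (2 ^ (n - j)) (2 ^ (n - j))" by simp
    have "local_pauli \<mu> * pauli_Z = - (pauli_Z * local_pauli \<mu>)"
      by (simp add: local_pauli)
    from anti[OF eq pauli_carrier(3) this R] show ?thesis .
  qed
qed

lemma majorana_anticommute:
  assumes "\<mu> \<in> {1..2 * n}" "\<nu> \<in> {1..2 * n}" "\<mu> \<noteq> \<nu>"
  shows "majorana n \<mu> * majorana n \<nu> = - (majorana n \<nu> * majorana n \<mu>)"
proof (cases "\<mu> < \<nu>")
  case False
  then have "majorana n \<nu> * majorana n \<mu> = - (majorana n \<mu> * majorana n \<nu>)"
    using assms by (intro majorana_anticommute_less) auto
  then show ?thesis by simp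
qed (use assms majorana_anticommute_less in blast)

text \<open>Strings extend only to the left, so the witness is the Majorana operator with the same
  index on m qubits.\<close>

lemma majorana_first_qubits:
  assumes "\<mu> \<in> {1..2 * m}" "m \<le> n"
  shows "\<exists>a \<in> carrier_mat (2 ^ m) (2 ^ m). majorana n \<mu> = kron a (1\<^sub>m (2 ^ (n - m)))"
proof (rule bexI[OF _ majorana_carrier[OF assms(1)]])
  obtain k where k: "1 \<le> k" "k \<le> m" "(\<mu> + 1) div 2 = k" using assms(1) by (rule majorana_mode)
  have "2 ^ (n - k) = (2 :: nat) ^ (m - k) * 2 ^ (n - m)"
    using k assms by (simp flip: power_add)
  then show "majorana n \<mu> = kron (majorana m \<mu>) (1\<^sub>m (2 ^ (n - m)))"
    using k assms by (simp add: majorana_eq[of k] kron_assoc kron_one_one)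
qed

lemma kron_commute:
  assumes "a \<in> carrier_mat d d" "P \<in> carrier_mat e e"
  shows "mat_commute (kron a (1\<^sub>m e)) (kron (1\<^sub>m d) P)"
  unfolding mat_commute_def kron_mult[OF assms(1) one_carrier_mat one_carrier_mat assms(2)]
    kron_mult[OF one_carrier_mat assms(1) assms(2) one_carrier_mat]
  using assms by simp

subsection \<open>Linear combinations of Majorana operators\<close>

lemma majorana_lincomb_carrier [simp]: "majorana_lincomb n c \<in> carrier_mat (2 ^ n) (2 ^ n)"
  by (simp add: majorana_lincomb_def)

lemma majorana_lincomb_index:
  "i < 2 ^ n \<Longrightarrow> j < 2 ^ n \<Longrightarrow> majorana_lincomb n c $$ (i, j) =
    (\<Sum>\<nu> = 1..2 * n. complex_of_real (c \<nu>) * majorana n \<nu> $$ (i, j))"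
  by (simp add: majorana_lincomb_def)

lemma majorana_lincomb_cong:
  "(\<And>\<nu>. \<nu> \<in> {1..2 * n} \<Longrightarrow> c \<nu> = d \<nu>) \<Longrightarrow> majorana_lincomb n c = majorana_lincomb n d"
  by (rule eq_matI) (auto simp: majorana_lincomb_def intro!: sum.cong)

lemma majorana_lincomb_unit:
  assumes "\<mu> \<in> {1..2 * n}"
  shows "majorana_lincomb n (\<lambda>\<nu>. if \<nu> = \<mu> then 1 else 0) = majorana n \<mu>"
proof (rule eq_matI)
  fix i j assume "i < dim_row (majorana n \<mu>)" "j < dim_col (majorana n \<mu>)"
  then have ij: "i < 2 ^ n" "j < 2 ^ n" using majorana_carrier[OF assms] by auto
  have "majorana_lincomb n (\<lambda>\<nu>. if \<nu> = \<mu> then 1 else 0) $$ (i, j) =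
      (\<Sum>\<nu> = 1..2 * n. if \<nu> = \<mu> then majorana n \<nu> $$ (i, j) else 0)"
    unfolding majorana_lincomb_index[OF ij] by (rule sum.cong) auto
  then show "majorana_lincomb n (\<lambda>\<nu>. if \<nu> = \<mu> then 1 else 0) $$ (i, j) = majorana n \<mu> $$ (i, j)"
    using assms by simp
qed (use majorana_carrier[OF assms] in \<open>auto simp: majorana_lincomb_def\<close>)

text \<open>Bilinearity of the product, stated entrywise because combinations are defined entrywise;
  sums of matrices never occur.\<close>

lemma mult_majorana_lincomb_index:
  assumes A: "A \<in> carrier_mat (2 ^ n) (2 ^ n)" and ij: "i < 2 ^ n" "j < 2 ^ n"
  shows "(A * majorana_lincomb n c) $$ (i, j) =
      (\<Sum>\<nu> = 1..2 * n. complex_of_real (c \<nu>) * (A * majorana n \<nu>) $$ (i, j))"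
    and "(majorana_lincomb n c * A) $$ (i, j) =
      (\<Sum>\<nu> = 1..2 * n. complex_of_real (c \<nu>) * (majorana n \<nu> * A) $$ (i, j))"
proof -
  have "(A * majorana_lincomb n c) $$ (i, j) = (\<Sum>l = 0..<2 ^ n. \<Sum>\<nu> = 1..2 * n.
      A $$ (i, l) * (complex_of_real (c \<nu>) * majorana n \<nu> $$ (l, j)))"
    using ij by (simp add: index_mult_mat_sum[OF A majorana_lincomb_carrier ij]
        majorana_lincomb_index sum_distrib_left)
  also have "\<dots> = (\<Sum>\<nu> = 1..2 * n. \<Sum>l = 0..<2 ^ n.
      A $$ (i, l) * (complex_of_real (c \<nu>) * majorana n \<nu> $$ (l, j)))"
    by (rule sum.swap)
  also have "\<dots> = (\<Sum>\<nu> = 1..2 * n. complex_of_real (c \<nu>) * (A * majorana n \<nu>) $$ (i, j))"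
    by (rule sum.cong) (auto simp: index_mult_mat_sum[OF A majorana_carrier ij]
        sum_distrib_left mult_ac intro!: sum.cong)
  finally show "(A * majorana_lincomb n c) $$ (i, j) =
      (\<Sum>\<nu> = 1..2 * n. complex_of_real (c \<nu>) * (A * majorana n \<nu>) $$ (i, j))" .
  have "(majorana_lincomb n c * A) $$ (i, j) = (\<Sum>l = 0..<2 ^ n. \<Sum>\<nu> = 1..2 * n.
      complex_of_real (c \<nu>) * majorana n \<nu> $$ (i, l) * A $$ (l, j))"
    using ij by (simp add: index_mult_mat_sum[OF majorana_lincomb_carrier A ij]
        majorana_lincomb_index sum_distrib_right)
  also have "\<dots> = (\<Sum>\<nu> = 1..2 * n. \<Sum>l = 0..<2 ^ n.
      complex_of_real (c \<nu>) * majorana n \<nu> $$ (i, l) * A $$ (l, j))"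
    by (rule sum.swap)
  also have "\<dots> = (\<Sum>\<nu> = 1..2 * n. complex_of_real (c \<nu>) * (majorana n \<nu> * A) $$ (i, j))"
    by (rule sum.cong) (auto simp: index_mult_mat_sum[OF majorana_carrier A ij]
        sum_distrib_left mult_ac intro!: sum.cong)
  finally show "(majorana_lincomb n c * A) $$ (i, j) =
      (\<Sum>\<nu> = 1..2 * n. complex_of_real (c \<nu>) * (majorana n \<nu> * A) $$ (i, j))" .
qed

text \<open>The guard \<open>c \<nu> \<noteq> 0\<close> makes only the support of c count; this
  turns compression onto the first indices into commutation with
  \<open>I \<otimes> P\<close>.\<close>

lemma mat_commute_majorana_lincomb:
  assumes B: "B \<in> carrier_mat (2 ^ n) (2 ^ n)"
    and comm: "\<And>\<nu>. \<nu> \<in> {1..2 * n} \<Longrightarrow> c \<nu> \<noteq> 0 \<Longrightarrow> mat_commute (majorana n \<nu>) B"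
  shows "mat_commute (majorana_lincomb n c) B"
  unfolding mat_commute_def
proof (rule eq_matI)
  fix i j assume "i < dim_row (B * majorana_lincomb n c)" "j < dim_col (B * majorana_lincomb n c)"
  then have ij: "i < 2 ^ n" "j < 2 ^ n" using B by (auto simp: majorana_lincomb_def)
  show "(majorana_lincomb n c * B) $$ (i, j) = (B * majorana_lincomb n c) $$ (i, j)"
    unfolding mult_majorana_lincomb_index[OF B ij]
  proof (intro sum.cong refl)
    fix \<nu> assume "\<nu> \<in> {1..2 * n}"
    then show "of_real (c \<nu>) * (majorana n \<nu> * B) $$ (i, j) = of_real (c \<nu>) * (B * majorana n \<nu>) $$ (i, j)"
      using comm[of \<nu>] by (cases "c \<nu> = 0") (simp_all add: mat_commute_def)
  qed
qed (use B in \<open>auto simp: majorana_lincomb_def\<close>)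

text \<open>The polarised Clifford relation: by bilinearity distinct indices cancel in pairs, and
  each equal pair contributes twice the identity.\<close>

lemma majorana_lincomb_anticommutator:
  "majorana_lincomb n c * majorana_lincomb n d + majorana_lincomb n d * majorana_lincomb n c =
    complex_of_real (2 * (\<Sum>\<nu> = 1..2 * n. c \<nu> * d \<nu>)) \<cdot>\<^sub>m 1\<^sub>m (2 ^ n)"
proof (rule eq_matI)
  fix i j
  assume "i < dim_row (complex_of_real (2 * (\<Sum>\<nu> = 1..2 * n. c \<nu> * d \<nu>)) \<cdot>\<^sub>m 1\<^sub>m (2 ^ n))"
    "j < dim_col (complex_of_real (2 * (\<Sum>\<nu> = 1..2 * n. c \<nu> * d \<nu>)) \<cdot>\<^sub>m 1\<^sub>m (2 ^ n))"
  then have ij: "i < 2 ^ n" "j < 2 ^ n" by auto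
  have anti: "(majorana n \<mu> * majorana n \<nu>) $$ (i, j) + (majorana n \<nu> * majorana n \<mu>) $$ (i, j) =
      (if \<nu> = \<mu> then 2 * 1\<^sub>m (2 ^ n) $$ (i, j) else 0)"
    if "\<mu> \<in> {1..2 * n}" "\<nu> \<in> {1..2 * n}" for \<mu> \<nu>
  proof (cases "\<nu> = \<mu>")
    case True
    then show ?thesis using majorana_square[OF that(1)] by simp
  next
    case False
    have "majorana n \<nu> * majorana n \<mu> \<in> carrier_mat (2 ^ n) (2 ^ n)"
      using that by (simp add: majorana_carrier)
    then show ?thesis using majorana_anticommute[OF that] False ij by (simp del: index_mult_mat)
  qed
  have mm: "majorana_lincomb n c * majorana n \<mu> \<in> carrier_mat (2 ^ n) (2 ^ n)"
    "majorana n \<mu> * majorana_lincomb n c \<in> carrier_mat (2 ^ n) (2 ^ n)"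
    if "\<mu> \<in> {1..2 * n}" for \<mu>
    using that by (simp_all add: majorana_carrier)
  have "(majorana_lincomb n c * majorana_lincomb n d + majorana_lincomb n d * majorana_lincomb n c) $$ (i, j) =
      (\<Sum>\<nu> = 1..2 * n. d \<nu> * (majorana_lincomb n c * majorana n \<nu>) $$ (i, j)) +
      (\<Sum>\<nu> = 1..2 * n. d \<nu> * (majorana n \<nu> * majorana_lincomb n c) $$ (i, j))"
    using ij by (simp add: mult_majorana_lincomb_index(1)[OF majorana_lincomb_carrier ij, of c d]
        mult_majorana_lincomb_index(2)[OF majorana_lincomb_carrier ij, of d c]
        carrier_matD[OF majorana_lincomb_carrier] del: index_mult_mat(1))
  also have "\<dots> = (\<Sum>\<nu> = 1..2 * n. \<Sum>\<mu> = 1..2 * n. of_real (d \<nu> * c \<mu>) *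
      ((majorana n \<mu> * majorana n \<nu>) $$ (i, j) + (majorana n \<nu> * majorana n \<mu>) $$ (i, j)))"
    unfolding sum.distrib[symmetric]
    by (rule sum.cong)
      (auto simp: mult_majorana_lincomb_index[OF majorana_carrier ij] sum_distrib_left
        distrib_left mult.assoc sum.distrib simp del: index_mult_mat(1))
  also have "\<dots> = (\<Sum>\<nu> = 1..2 * n. \<Sum>\<mu> = 1..2 * n.
      if \<nu> = \<mu> then of_real (d \<nu> * c \<mu>) * (2 * 1\<^sub>m (2 ^ n) $$ (i, j)) else 0)"
    by (intro sum.cong refl) (auto simp: anti simp del: index_mult_mat(1))
  also have "\<dots> = (\<Sum>\<nu> = 1..2 * n. of_real (d \<nu> * c \<nu>) * (2 * 1\<^sub>m (2 ^ n) $$ (i, j)))"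
    by (rule sum.cong) auto
  also have "\<dots> = (complex_of_real (2 * (\<Sum>\<nu> = 1..2 * n. c \<nu> * d \<nu>)) \<cdot>\<^sub>m 1\<^sub>m (2 ^ n)) $$ (i, j)"
    using ij by (simp add: sum_distrib_left sum_distrib_right mult_ac)
  finally show "(majorana_lincomb n c * majorana_lincomb n d + majorana_lincomb n d * majorana_lincomb n c) $$ (i, j) =
      (complex_of_real (2 * (\<Sum>\<nu> = 1..2 * n. c \<nu> * d \<nu>)) \<cdot>\<^sub>m 1\<^sub>m (2 ^ n)) $$ (i, j)" .
qed (auto simp: majorana_lincomb_def)

lemma majorana_lincomb_adjoint: "mat_adjoint (majorana_lincomb n c) = majorana_lincomb n c"
proof (rule eq_matI)
  fix i j assume "i < dim_row (majorana_lincomb n c)" "j < dim_col (majorana_lincomb n c)"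
  then have ij: "i < 2 ^ n" "j < 2 ^ n" by (auto simp: majorana_lincomb_def)
  have "cnj (majorana n \<nu> $$ (j, i)) = majorana n \<nu> $$ (i, j)" if "\<nu> \<in> {1..2 * n}" for \<nu>
    using mat_adjoint_index[of i "majorana n \<nu>" j] majorana_carrier[OF that] ij
    by (simp add: majorana_adjoint[OF that])
  then show "mat_adjoint (majorana_lincomb n c) $$ (i, j) = majorana_lincomb n c $$ (i, j)"
    using ij by (simp add: mat_adjoint_index carrier_matD[OF majorana_lincomb_carrier]
        majorana_lincomb_index)
qed (auto simp: majorana_lincomb_def)

lemma majorana_lincomb_square:
  assumes "(\<Sum>\<nu> = 1..2 * n. u \<nu> * u \<nu>) = (1 :: real)"
  shows "majorana_lincomb n u * majorana_lincomb n u = 1\<^sub>m (2 ^ n)"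
proof (rule eq_matI)
  let ?C = "majorana_lincomb n u * majorana_lincomb n u"
  have c: "?C \<in> carrier_mat (2 ^ n) (2 ^ n)" by simp
  fix i j assume "i < dim_row (1\<^sub>m (2 ^ n) :: complex mat)" "j < dim_col (1\<^sub>m (2 ^ n) :: complex mat)"
  then have ij: "i < 2 ^ n" "j < 2 ^ n" by auto
  \<comment> \<open>The anticommutator of c(u) with itself is twice its square, so the claim follows
    by halving each entry.\<close>
  have "(?C + ?C) $$ (i, j) = (2 \<cdot>\<^sub>m 1\<^sub>m (2 ^ n)) $$ (i, j)"
    unfolding majorana_lincomb_anticommutator assms by simp
  then show "?C $$ (i, j) = 1\<^sub>m (2 ^ n) $$ (i, j)"
    using ij carrier_matD[OF c] by (simp del: index_mult_mat(1) index_one_mat(1))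
qed (auto simp: majorana_lincomb_def)

lemma majorana_lincomb_unitary:
  assumes "(\<Sum>\<nu> = 1..2 * n. u \<nu> * u \<nu>) = 1"
  shows "unitary_mat (2 ^ n) (majorana_lincomb n u)"
  using majorana_lincomb_square[OF assms]
  by (simp add: unitary_mat_def majorana_lincomb_adjoint)

text \<open>Conjugation by \<open>c(u)\<close> is minus the reflection in the hyperplane orthogonal to \<open>u\<close>.\<close>

lemma majorana_lincomb_reflection:
  assumes "(\<Sum>\<nu> = 1..2 * n. u \<nu> * u \<nu>) = 1"
  shows "majorana_lincomb n u * majorana_lincomb n w * majorana_lincomb n u =
    majorana_lincomb n (\<lambda>\<nu>. 2 * (\<Sum>\<kappa> = 1..2 * n. u \<kappa> * w \<kappa>) * u \<nu> - w \<nu>)"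
proof -
  define s where "s = (\<Sum>\<kappa> = 1..2 * n. u \<kappa> * w \<kappa>)"
  let ?U = "majorana_lincomb n u" and ?W = "majorana_lincomb n w"
  have c: "?U \<in> carrier_mat (2 ^ n) (2 ^ n)" "?W \<in> carrier_mat (2 ^ n) (2 ^ n)"
    "?U * ?W \<in> carrier_mat (2 ^ n) (2 ^ n)" "?W * ?U \<in> carrier_mat (2 ^ n) (2 ^ n)"
    by auto
  \<comment> \<open>As U squares to 1, adding W = W U U completes the product to the anticommutator
    of U and W times U, and this anticommutator is a scalar.\<close>
  have "?U * ?W * ?U + ?W = ?U * ?W * ?U + ?W * (?U * ?U)"
    by (simp add: majorana_lincomb_square[OF assms] right_mult_one_mat[OF c(2)])
  also have "\<dots> = (?U * ?W + ?W * ?U) * ?U"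
    by (simp add: add_mult_distrib_mat[OF c(3,4,1)] assoc_mult_mat[OF c(2,1,1)])
  also have "\<dots> = of_real (2 * s) \<cdot>\<^sub>m ?U"
    unfolding majorana_lincomb_anticommutator s_def[symmetric]
    by (simp add: mult_smult_assoc_mat[OF one_carrier_mat c(1)] left_mult_one_mat[OF c(1)])
  finally have sum: "?U * ?W * ?U + ?W = of_real (2 * s) \<cdot>\<^sub>m ?U" .
  show ?thesis
  proof (rule eq_matI)
    have d: "?U * ?W * ?U \<in> carrier_mat (2 ^ n) (2 ^ n)" using c by auto
    fix i j
    assume "i < dim_row (majorana_lincomb n (\<lambda>\<nu>. 2 * (\<Sum>\<kappa> = 1..2 * n. u \<kappa> * w \<kappa>) * u \<nu> - w \<nu>))"
      "j < dim_col (majorana_lincomb n (\<lambda>\<nu>. 2 * (\<Sum>\<kappa> = 1..2 * n. u \<kappa> * w \<kappa>) * u \<nu> - w \<nu>))"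
    then have ij: "i < 2 ^ n" "j < 2 ^ n" by (auto simp: majorana_lincomb_def)
    have "(?U * ?W * ?U) $$ (i, j) + ?W $$ (i, j) = of_real (2 * s) * ?U $$ (i, j)"
      using arg_cong[OF sum, of "\<lambda>M. M $$ (i, j)"] ij
      by (simp add: carrier_matD[OF c(1)] carrier_matD[OF c(2)] del: index_mult_mat(1))
    then have "(?U * ?W * ?U) $$ (i, j) = of_real (2 * s) * ?U $$ (i, j) - ?W $$ (i, j)"
      by (simp add: algebra_simps del: index_mult_mat(1))
    then show "(?U * ?W * ?U) $$ (i, j) =
        majorana_lincomb n (\<lambda>\<nu>. 2 * (\<Sum>\<kappa> = 1..2 * n. u \<kappa> * w \<kappa>) * u \<nu> - w \<nu>) $$ (i, j)"
      unfolding s_def[symmetric] majorana_lincomb_index[OF ij]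
      by (simp add: sum_subtractf sum_distrib_left algebra_simps)
  qed (auto simp: majorana_lincomb_def)
qed

subsection \<open>Gaussian unitaries\<close>

lemma gaussian_unitary_unitary: "gaussian_unitary n G \<Longrightarrow> unitary_mat (2 ^ n) G"
  by (simp add: gaussian_unitary_def)

lemma gaussian_unitary_carrier: "gaussian_unitary n G \<Longrightarrow> G \<in> carrier_mat (2 ^ n) (2 ^ n)"
  by (simp add: gaussian_unitary_def unitary_mat_def)

text \<open>Coefficients transform as a row vector multiplied by q from the right, so composing
  conjugations multiplies matrices in the order of the unitaries.\<close>

lemma conj_majorana_lincomb:
  assumes G: "G \<in> carrier_mat (2 ^ n) (2 ^ n)"
    and conj: "\<And>\<mu>. \<mu> \<in> {1..2 * n} \<Longrightarrow>
      mat_adjoint G * majorana n \<mu> * G = majorana_lincomb n (q \<mu>)"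
  shows "mat_adjoint G * majorana_lincomb n c * G =
    majorana_lincomb n (\<lambda>\<nu>. \<Sum>\<mu> = 1..2 * n. c \<mu> * q \<mu> \<nu>)"
proof (rule eq_matI)
  let ?D = "(2 :: nat) ^ n"
  have G': "mat_adjoint G \<in> carrier_mat ?D ?D" using G by simp
  fix i j assume "i < dim_row (majorana_lincomb n (\<lambda>\<nu>. \<Sum>\<mu> = 1..2 * n. c \<mu> * q \<mu> \<nu>))"
    "j < dim_col (majorana_lincomb n (\<lambda>\<nu>. \<Sum>\<mu> = 1..2 * n. c \<mu> * q \<mu> \<nu>))"
  then have ij: "i < ?D" "j < ?D" by (auto simp: majorana_lincomb_def)
  have "(mat_adjoint G * majorana_lincomb n c * G) $$ (i, j) =
      (\<Sum>l = 0..<?D. (mat_adjoint G * majorana_lincomb n c) $$ (i, l) * G $$ (l, j))"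
    using G' by (intro index_mult_mat_sum[OF _ G ij]) simp
  also have "\<dots> = (\<Sum>l = 0..<?D. \<Sum>\<mu> = 1..2 * n.
      of_real (c \<mu>) * (mat_adjoint G * majorana n \<mu>) $$ (i, l) * G $$ (l, j))"
    by (intro sum.cong refl)
      (auto simp: mult_majorana_lincomb_index(1)[OF G' ij(1)] sum_distrib_right simp del: index_mult_mat(1))
  also have "\<dots> = (\<Sum>\<mu> = 1..2 * n. \<Sum>l = 0..<?D.
      of_real (c \<mu>) * (mat_adjoint G * majorana n \<mu>) $$ (i, l) * G $$ (l, j))"
    by (rule sum.swap)
  also have "\<dots> = (\<Sum>\<mu> = 1..2 * n. of_real (c \<mu>) * majorana_lincomb n (q \<mu>) $$ (i, j))"
  proof (intro sum.cong refl)
    fix \<mu> assume \<mu>: "\<mu> \<in> {1..2 * n}"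
    have "mat_adjoint G * majorana n \<mu> \<in> carrier_mat ?D ?D"
      using G' majorana_carrier[OF \<mu>] by simp
    then show "(\<Sum>l = 0..<?D. of_real (c \<mu>) * (mat_adjoint G * majorana n \<mu>) $$ (i, l) * G $$ (l, j)) =
        of_real (c \<mu>) * majorana_lincomb n (q \<mu>) $$ (i, j)"
      unfolding conj[OF \<mu>, symmetric]
      by (simp only: index_mult_mat_sum[OF _ G ij] sum_distrib_left mult.assoc)
  qed
  also have "\<dots> = (\<Sum>\<mu> = 1..2 * n. \<Sum>\<nu> = 1..2 * n. of_real (c \<mu> * q \<mu> \<nu>) * majorana n \<nu> $$ (i, j))"
    by (simp add: majorana_lincomb_index[OF ij] sum_distrib_left mult.assoc)
  also have "\<dots> = (\<Sum>\<nu> = 1..2 * n. \<Sum>\<mu> = 1..2 * n. of_real (c \<mu> * q \<mu> \<nu>) * majorana n \<nu> $$ (i, j))"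
    by (rule sum.swap)
  also have "\<dots> = majorana_lincomb n (\<lambda>\<nu>. \<Sum>\<mu> = 1..2 * n. c \<mu> * q \<mu> \<nu>) $$ (i, j)"
    by (simp add: majorana_lincomb_index[OF ij] sum_distrib_right)
  finally show "(mat_adjoint G * majorana_lincomb n c * G) $$ (i, j) =
      majorana_lincomb n (\<lambda>\<nu>. \<Sum>\<mu> = 1..2 * n. c \<mu> * q \<mu> \<nu>) $$ (i, j)" .
qed (use G in \<open>auto simp: majorana_lincomb_def\<close>)

lemma gaussian_unitaryE:
  assumes "gaussian_unitary n G"
  obtains Q where "real_orthogonal_mat (2 * n) Q"
    "\<And>\<mu>. \<mu> \<in> {1..2 * n} \<Longrightarrow> mat_adjoint G * majorana n \<mu> * G =
      majorana_lincomb n (\<lambda>\<nu>. Q $$ (\<mu> - 1, \<nu> - 1))"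
  using assms unfolding gaussian_unitary_def by blast

lemma gaussian_unitary_conj_lincomb:
  assumes "gaussian_unitary n G"
  shows "\<exists>d. mat_adjoint G * majorana_lincomb n c * G = majorana_lincomb n d"
proof -
  obtain Q where "\<And>\<mu>. \<mu> \<in> {1..2 * n} \<Longrightarrow> mat_adjoint G * majorana n \<mu> * G =
      majorana_lincomb n (\<lambda>\<nu>. Q $$ (\<mu> - 1, \<nu> - 1))"
    using assms by (rule gaussian_unitaryE) blast
  from conj_majorana_lincomb[OF gaussian_unitary_carrier[OF assms] this] show ?thesis by blast
qed

lemma real_orthogonal_mat_mult:
  assumes "real_orthogonal_mat d P" "real_orthogonal_mat d Q"
  shows "real_orthogonal_mat d (P * Q)"
proof -
  have c: "P \<in> carrier_mat d d" "Q \<in> carrier_mat d d"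
    "transpose_mat P \<in> carrier_mat d d" "transpose_mat Q \<in> carrier_mat d d"
    and p: "transpose_mat P * P = 1\<^sub>m d" "P * transpose_mat P = 1\<^sub>m d"
    and q: "transpose_mat Q * Q = 1\<^sub>m d" "Q * transpose_mat Q = 1\<^sub>m d"
    using assms by (auto simp: real_orthogonal_mat_def)
  have t: "transpose_mat (P * Q) = transpose_mat Q * transpose_mat P"
    using c(1,2) by (rule transpose_mult)
  have "transpose_mat (P * Q) * (P * Q) = transpose_mat Q * ((transpose_mat P * P) * Q)"
    "(P * Q) * transpose_mat (P * Q) = P * ((Q * transpose_mat Q) * transpose_mat P)"
    unfolding t using c by (simp_all add: assoc_mult_mat[of _ d d _ d _ d])
  then show ?thesis
    using c(1,2) by (simp add: real_orthogonal_mat_def p q left_mult_one_mat[OF c(2)] left_mult_one_mat[OF c(3)])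
qed

text \<open>Conjugation by G H is conjugation by G followed by conjugation by H, which yields the
  orthogonal matrix P Q in the same order.\<close>

lemma gaussian_unitary_mult:
  assumes "gaussian_unitary n G" "gaussian_unitary n H"
  shows "gaussian_unitary n (G * H)"
proof -
  have c: "G \<in> carrier_mat (2 ^ n) (2 ^ n)" "H \<in> carrier_mat (2 ^ n) (2 ^ n)"
    "mat_adjoint G \<in> carrier_mat (2 ^ n) (2 ^ n)" "mat_adjoint H \<in> carrier_mat (2 ^ n) (2 ^ n)"
    using assms by (simp_all add: gaussian_unitary_carrier)
  obtain P where P: "real_orthogonal_mat (2 * n) P"
    "\<And>\<mu>. \<mu> \<in> {1..2 * n} \<Longrightarrow> mat_adjoint G * majorana n \<mu> * G =
      majorana_lincomb n (\<lambda>\<nu>. P $$ (\<mu> - 1, \<nu> - 1))"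
    using assms(1) by (rule gaussian_unitaryE) blast
  obtain Q where Q: "real_orthogonal_mat (2 * n) Q"
    "\<And>\<mu>. \<mu> \<in> {1..2 * n} \<Longrightarrow> mat_adjoint H * majorana n \<mu> * H =
      majorana_lincomb n (\<lambda>\<nu>. Q $$ (\<mu> - 1, \<nu> - 1))"
    using assms(2) by (rule gaussian_unitaryE) blast
  have pq: "P \<in> carrier_mat (2 * n) (2 * n)" "Q \<in> carrier_mat (2 * n) (2 * n)"
    using P Q by (auto simp: real_orthogonal_mat_def)
  have "mat_adjoint (G * H) * majorana n \<mu> * (G * H) =
      majorana_lincomb n (\<lambda>\<nu>. (P * Q) $$ (\<mu> - 1, \<nu> - 1))" if \<mu>: "\<mu> \<in> {1..2 * n}" for \<mu>
  proof -
    have "mat_adjoint (G * H) * majorana n \<mu> * (G * H) =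
        mat_adjoint H * (mat_adjoint G * majorana n \<mu> * G) * H"
      using c majorana_carrier[OF \<mu>]
      by (simp add: mat_adjoint_mult[OF c(1,2)] assoc_mult_mat[of _ "2 ^ n" "2 ^ n" _ "2 ^ n" _ "2 ^ n"])
    also have "\<dots> = majorana_lincomb n
        (\<lambda>\<nu>. \<Sum>\<kappa> = 1..2 * n. P $$ (\<mu> - 1, \<kappa> - 1) * Q $$ (\<kappa> - 1, \<nu> - 1))"
      unfolding P(2)[OF \<mu>] by (rule conj_majorana_lincomb[OF c(2) Q(2)])
    also have "\<dots> = majorana_lincomb n (\<lambda>\<nu>. (P * Q) $$ (\<mu> - 1, \<nu> - 1))"
    proof (rule majorana_lincomb_cong)
      fix \<nu> assume "\<nu> \<in> {1..2 * n}"
      then have "\<mu> - 1 < 2 * n" "\<nu> - 1 < 2 * n" using \<mu> by auto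
      \<comment> \<open>Shifting the summation range from 1..2n to 0..<2n reconciles Majorana
        indices with matrix indices.\<close>
      from index_mult_mat_sum[OF pq this]
      show "(\<Sum>\<kappa> = 1..2 * n. P $$ (\<mu> - 1, \<kappa> - 1) * Q $$ (\<kappa> - 1, \<nu> - 1)) = (P * Q) $$ (\<mu> - 1, \<nu> - 1)"
        by (simp add: sum.atLeast1_atMost_eq atLeast0LessThan)
    qed
    finally show ?thesis .
  qed
  then show ?thesis
    using real_orthogonal_mat_mult[OF P(1) Q(1)] unitary_mat_mult assms
    unfolding gaussian_unitary_def by blast
qed

text \<open>The orthogonal matrix is the transpose of Q. The candidate image \<open>?X\<close> is
  conjugated by G, where \<open>Q\<^sup>T * Q = 1\<close> collapses it to a single Majorana
  operator; undoing the conjugation gives the claim.\<close>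

lemma gaussian_unitary_adjoint:
  assumes "gaussian_unitary n G"
  shows "gaussian_unitary n (mat_adjoint G)"
proof -
  have G: "unitary_mat (2 ^ n) G" "G \<in> carrier_mat (2 ^ n) (2 ^ n)"
    using assms by (simp_all add: gaussian_unitary_unitary gaussian_unitary_carrier)
  obtain Q where Q: "real_orthogonal_mat (2 * n) Q"
    "\<And>\<mu>. \<mu> \<in> {1..2 * n} \<Longrightarrow> mat_adjoint G * majorana n \<mu> * G =
      majorana_lincomb n (\<lambda>\<nu>. Q $$ (\<mu> - 1, \<nu> - 1))"
    using assms by (rule gaussian_unitaryE) blast
  have q: "Q \<in> carrier_mat (2 * n) (2 * n)" "transpose_mat Q \<in> carrier_mat (2 * n) (2 * n)"
    "transpose_mat Q * Q = 1\<^sub>m (2 * n)"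
    using Q by (auto simp: real_orthogonal_mat_def)
  have "mat_adjoint (mat_adjoint G) * majorana n \<mu> * mat_adjoint G =
      majorana_lincomb n (\<lambda>\<nu>. transpose_mat Q $$ (\<mu> - 1, \<nu> - 1))" if \<mu>: "\<mu> \<in> {1..2 * n}" for \<mu>
  proof -
    let ?X = "majorana_lincomb n (\<lambda>\<nu>. transpose_mat Q $$ (\<mu> - 1, \<nu> - 1))"
    have "mat_adjoint G * ?X * G = majorana_lincomb n
        (\<lambda>\<nu>. \<Sum>\<kappa> = 1..2 * n. transpose_mat Q $$ (\<mu> - 1, \<kappa> - 1) * Q $$ (\<kappa> - 1, \<nu> - 1))"
      by (rule conj_majorana_lincomb[OF G(2) Q(2)])
    also have "\<dots> = majorana_lincomb n (\<lambda>\<nu>. if \<nu> = \<mu> then 1 else 0)"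
    proof (rule majorana_lincomb_cong)
      fix \<nu> assume "\<nu> \<in> {1..2 * n}"
      then have b: "\<mu> - 1 < 2 * n" "\<nu> - 1 < 2 * n" and e: "\<mu> - 1 = \<nu> - 1 \<longleftrightarrow> \<nu> = \<mu>" using \<mu> by auto
      from index_mult_mat_sum[OF q(2,1) b] b e
      show "(\<Sum>\<kappa> = 1..2 * n. transpose_mat Q $$ (\<mu> - 1, \<kappa> - 1) * Q $$ (\<kappa> - 1, \<nu> - 1)) =
          (if \<nu> = \<mu> then 1 else 0)"
        by (simp add: sum.atLeast1_atMost_eq atLeast0LessThan q(3) del: index_transpose_mat)
    qed
    also have "\<dots> = majorana n \<mu>" by (rule majorana_lincomb_unit[OF \<mu>])
    finally have "G * (mat_adjoint G * ?X * G) * mat_adjoint G = G * majorana n \<mu> * mat_adjoint G"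
      by simp
    then show ?thesis by (simp only: unitary_conj_cancel(1)[OF G(1) majorana_lincomb_carrier] mat_adjoint_adjoint)
  qed
  moreover have "real_orthogonal_mat (2 * n) (transpose_mat Q)"
    using Q(1) by (simp add: real_orthogonal_mat_def)
  ultimately show ?thesis
    using unitary_mat_adjoint[OF G(1)] unfolding gaussian_unitary_def by blast
qed

text \<open>The orthogonal matrix is 2 u u^T - 1, symmetric and, for a unit vector u, its own
  inverse.\<close>

lemma gaussian_unitary_majorana_lincomb:
  assumes "(\<Sum>\<nu> = 1..2 * n. u \<nu> * u \<nu>) = 1"
  shows "gaussian_unitary n (majorana_lincomb n u)"
proof -
  define Q where "Q = mat (2 * n) (2 * n)
    (\<lambda>(i, j). 2 * u (Suc i) * u (Suc j) - (if i = j then 1 else 0))"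
  have Q: "Q \<in> carrier_mat (2 * n) (2 * n)" "transpose_mat Q = Q"
    by (auto simp: Q_def intro!: eq_matI)
  have norm: "(\<Sum>l = 0..<2 * n. u (Suc l) * u (Suc l)) = 1"
    using assms by (simp add: sum.atLeast1_atMost_eq atLeast0LessThan)
  have "Q * Q = 1\<^sub>m (2 * n)"
  proof (rule eq_matI)
    fix i j assume "i < dim_row (1\<^sub>m (2 * n) :: real mat)" "j < dim_col (1\<^sub>m (2 * n) :: real mat)"
    then have ij: "i < 2 * n" "j < 2 * n" by auto
    \<comment> \<open>Expansion of the square as 4 u (u^T u) u^T - 2 u u^T - 2 u u^T + 1, the
      identity written as a Kronecker delta.\<close>
    have "(Q * Q) $$ (i, j) = (\<Sum>l = 0..<2 * n.
        4 * u (Suc i) * u (Suc j) * (u (Suc l) * u (Suc l))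
        - (if l = i then 2 * u (Suc i) * u (Suc j) else 0)
        - (if l = j then 2 * u (Suc i) * u (Suc j) else 0)
        + (if l = i then if i = j then 1 else 0 else 0))"
      unfolding index_mult_mat_sum[OF Q(1) Q(1) ij]
      using ij by (intro sum.cong refl) (auto simp: Q_def algebra_simps)
    also have "\<dots> = 1\<^sub>m (2 * n) $$ (i, j)"
      using ij by (simp add: sum.distrib sum_subtractf flip: sum_distrib_left) (simp add: norm)
    finally show "(Q * Q) $$ (i, j) = 1\<^sub>m (2 * n) $$ (i, j)" .
  qed (auto simp: Q_def)
  then have orth: "real_orthogonal_mat (2 * n) Q" using Q by (simp add: real_orthogonal_mat_def)
  have "mat_adjoint (majorana_lincomb n u) * majorana n \<mu> * majorana_lincomb n u =
      majorana_lincomb n (\<lambda>\<nu>. Q $$ (\<mu> - 1, \<nu> - 1))" if \<mu>: "\<mu> \<in> {1..2 * n}" for \<mu>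
  proof -
    have "(\<Sum>\<kappa> = 1..2 * n. u \<kappa> * (if \<kappa> = \<mu> then 1 else 0)) = u \<mu>"
      using \<mu> by (simp add: if_distrib[of "(*) _"] cong: if_cong)
    then have "mat_adjoint (majorana_lincomb n u) * majorana n \<mu> * majorana_lincomb n u =
        majorana_lincomb n (\<lambda>\<nu>. 2 * u \<mu> * u \<nu> - (if \<nu> = \<mu> then 1 else 0))"
      using majorana_lincomb_reflection[OF assms, of "\<lambda>\<nu>. if \<nu> = \<mu> then 1 else 0"]
      by (simp only: majorana_lincomb_adjoint majorana_lincomb_unit[OF \<mu>])
    also have "\<dots> = majorana_lincomb n (\<lambda>\<nu>. Q $$ (\<mu> - 1, \<nu> - 1))"
      using \<mu> by (intro majorana_lincomb_cong) (auto simp: Q_def)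
    finally show ?thesis .
  qed
  then show ?thesis
    using orth majorana_lincomb_unitary[OF assms] unfolding gaussian_unitary_def by blast
qed

lemma gaussian_unitary_one: "gaussian_unitary n (1\<^sub>m (2 ^ n))"
proof -
  have "mat_adjoint (1\<^sub>m (2 ^ n)) * majorana n \<mu> * 1\<^sub>m (2 ^ n) =
      majorana_lincomb n (\<lambda>\<nu>. 1\<^sub>m (2 * n) $$ (\<mu> - 1, \<nu> - 1))" if \<mu>: "\<mu> \<in> {1..2 * n}" for \<mu>
  proof -
    have "majorana_lincomb n (\<lambda>\<nu>. 1\<^sub>m (2 * n) $$ (\<mu> - 1, \<nu> - 1)) = majorana n \<mu>"
      unfolding majorana_lincomb_unit[OF \<mu>, symmetric]
      using \<mu> by (intro majorana_lincomb_cong) auto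
    then show ?thesis using majorana_carrier[OF \<mu>] by simp
  qed
  then show ?thesis
    using unitary_mat_one unfolding gaussian_unitary_def real_orthogonal_mat_def
    by (intro conjI exI[of _ "1\<^sub>m (2 * n)"]) auto
qed

subsection \<open>Compressing linear combinations onto the first Majorana operators\<close>

text \<open>Householder's choice: the reflection vector is the tail of \<open>c\<close> beyond \<open>N\<close> plus its norm in
  direction \<open>N + 1\<close>. It vanishes up to \<open>N\<close>, so combinations already supported there keep their
  support.\<close>

lemma gaussian_unitary_householder:
  fixes c :: "nat \<Rightarrow> real"
  assumes "N < 2 * n"
  obtains G where "gaussian_unitary n G"
    "\<And>d. (\<And>\<nu>. \<nu> \<in> {N<..2 * n} \<Longrightarrow> d \<nu> = 0) \<Longrightarrow>
      \<exists>d'. (\<forall>\<nu> \<in> {N<..2 * n}. d' \<nu> = 0) \<and>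
        mat_adjoint G * majorana_lincomb n d * G = majorana_lincomb n d'"
    "\<exists>c'. (\<forall>\<nu> \<in> {Suc N<..2 * n}. c' \<nu> = 0) \<and>
        mat_adjoint G * majorana_lincomb n c * G = majorana_lincomb n c'"
proof -
  define h where "h \<nu> = (if \<nu> \<le> N then 0 else c \<nu>)" for \<nu>
  define r where "r = sqrt (\<Sum>\<nu> = 1..2 * n. h \<nu> * h \<nu>)"
  define x where "x \<nu> = h \<nu> + (if \<nu> = Suc N then r else 0)" for \<nu>
  define q where "q = (\<Sum>\<nu> = 1..2 * n. x \<nu> * x \<nu>)"
  have x0: "x \<nu> = 0" if "\<nu> \<le> N" for \<nu> using that by (simp add: x_def h_def)
  have r2: "r * r = (\<Sum>\<nu> = 1..2 * n. h \<nu> * h \<nu>)"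
    unfolding r_def by (simp add: sum_nonneg)
  \<comment> \<open>This identity makes the factor 2 <x, c> / q equal to 1, so that c is sent to x -
    c. Termwise the difference is a delta of weight r^2 at N + 1 minus h^2, and r^2 is the total of
    h^2.\<close>
  have "q - 2 * (\<Sum>\<nu> = 1..2 * n. x \<nu> * c \<nu>) = (\<Sum>\<nu> = 1..2 * n. x \<nu> * x \<nu> - 2 * (x \<nu> * c \<nu>))"
    by (simp add: q_def sum_subtractf sum_distrib_left)
  also have "\<dots> = (\<Sum>\<nu> = 1..2 * n. (if \<nu> = Suc N then r * r else 0) - h \<nu> * h \<nu>)"
    by (rule sum.cong) (auto simp: x_def h_def algebra_simps)
  also have "\<dots> = 0" using assms by (simp add: sum_subtractf r2)
  finally have q: "q = 2 * (\<Sum>\<nu> = 1..2 * n. x \<nu> * c \<nu>)" by simp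
  show thesis
  proof (cases "q = 0")
    \<comment> \<open>Since r enters with a fixed sign, x can vanish. The tail of c beyond N + 1 is
      then already zero, and the identity serves as G.\<close>
    case True
    then have xz: "x \<nu> = 0" if "\<nu> \<in> {1..2 * n}" for \<nu>
      using that unfolding q_def by (subst (asm) sum_nonneg_eq_0_iff) auto
    have c0: "c \<nu> = 0" if "\<nu> \<in> {Suc N<..2 * n}" for \<nu>
      using xz[of \<nu>] that by (auto simp: x_def h_def)
    have one: "mat_adjoint (1\<^sub>m (2 ^ n)) * majorana_lincomb n d * 1\<^sub>m (2 ^ n) = majorana_lincomb n d" for d
      using right_mult_one_mat[OF majorana_lincomb_carrier] left_mult_one_mat[OF majorana_lincomb_carrier]
      by simp
    show ?thesis by (rule that[OF gaussian_unitary_one]) (use one c0 in blast)+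
  next
    case False
    have "0 \<le> q" unfolding q_def by (intro sum_nonneg) simp
    with False have "0 < q" by simp
    define u where "u \<nu> = x \<nu> / sqrt q" for \<nu>
    have uu: "(\<Sum>\<nu> = 1..2 * n. u \<nu> * u \<nu>) = 1"
      using \<open>0 < q\<close> by (simp add: u_def flip: sum_divide_distrib) (simp add: q_def)
    \<comment> \<open>The two square roots from normalising u combine to 1 / q.\<close>
    have conj: "mat_adjoint (majorana_lincomb n u) * majorana_lincomb n w * majorana_lincomb n u =
        majorana_lincomb n (\<lambda>\<nu>. 2 * (\<Sum>\<kappa> = 1..2 * n. x \<kappa> * w \<kappa>) / q * x \<nu> - w \<nu>)" for w
    proof -
      have "2 * (\<Sum>\<kappa> = 1..2 * n. u \<kappa> * w \<kappa>) * u \<nu> = 2 * (\<Sum>\<kappa> = 1..2 * n. x \<kappa> * w \<kappa>) / q * x \<nu>" for \<nu>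
      proof -
        have "(\<Sum>\<kappa> = 1..2 * n. u \<kappa> * w \<kappa>) = (\<Sum>\<kappa> = 1..2 * n. x \<kappa> * w \<kappa>) / sqrt q"
          by (simp add: u_def sum_divide_distrib)
        then show ?thesis using \<open>0 < q\<close> by (simp add: u_def)
      qed
      then show ?thesis
        unfolding majorana_lincomb_adjoint majorana_lincomb_reflection[OF uu] by simp
    qed
    show ?thesis
    proof (rule that[OF gaussian_unitary_majorana_lincomb[OF uu]])
      fix d :: "nat \<Rightarrow> real" assume d: "\<And>\<nu>. \<nu> \<in> {N<..2 * n} \<Longrightarrow> d \<nu> = 0"
      \<comment> \<open>x lives beyond N and d up to N; with zero inner product d is sent to -d,
        which has the same support.\<close>
      have "(\<Sum>\<kappa> = 1..2 * n. x \<kappa> * d \<kappa>) = 0"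
      proof (rule sum.neutral, rule ballI)
        fix \<kappa> assume "\<kappa> \<in> {1..2 * n}"
        then show "x \<kappa> * d \<kappa> = 0" using x0[of \<kappa>] d[of \<kappa>] by (cases "\<kappa> \<le> N") auto
      qed
      then show "\<exists>d'. (\<forall>\<nu> \<in> {N<..2 * n}. d' \<nu> = 0) \<and>
          mat_adjoint (majorana_lincomb n u) * majorana_lincomb n d * majorana_lincomb n u =
          majorana_lincomb n d'"
        using d by (intro exI conjI, rule_tac [2] conj) simp
    next
      show "\<exists>c'. (\<forall>\<nu> \<in> {Suc N<..2 * n}. c' \<nu> = 0) \<and>
          mat_adjoint (majorana_lincomb n u) * majorana_lincomb n c * majorana_lincomb n u =
          majorana_lincomb n c'"
      proof (intro exI conjI ballI)
        fix \<nu> assume \<nu>: "\<nu> \<in> {Suc N<..2 * n}"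
        \<comment> \<open>The image of c is x - c, and x agrees with c beyond N + 1.\<close>
        have "2 * (\<Sum>\<kappa> = 1..2 * n. x \<kappa> * c \<kappa>) / q = 1" unfolding q[symmetric] using \<open>0 < q\<close> by simp
        then show "2 * (\<Sum>\<kappa> = 1..2 * n. x \<kappa> * c \<kappa>) / q * x \<nu> - c \<nu> = 0"
          using \<nu> by (simp only:) (simp add: x_def h_def)
      qed (rule conj)
    qed
  qed
qed

text \<open>Each element of C costs one further index: the new element is first rotated by the
  unitary built so far, then a Householder step with N = card C confines it to the first N + 1
  indices and keeps the earlier images within the first N.\<close>

lemma gaussian_unitary_compress:
  assumes "finite C" "C \<subseteq> range (majorana_lincomb n)" "card C \<le> 2 * n"
  shows "\<exists>G. gaussian_unitary n G \<and> (\<forall>A \<in> C. \<exists>d. (\<forall>\<nu> \<in> {card C<..2 * n}. d \<nu> = 0) \<and>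
    mat_adjoint G * A * G = majorana_lincomb n d)"
  using assms
proof (induction C rule: finite_induct)
  case empty
  then show ?case using gaussian_unitary_one by auto
next
  case (insert A C)
  let ?N = "card C"
  have N: "?N < 2 * n" "card (insert A C) = Suc ?N" using insert by auto
  obtain G where G: "gaussian_unitary n G"
    "\<And>B. B \<in> C \<Longrightarrow> \<exists>d. (\<forall>\<nu> \<in> {?N<..2 * n}. d \<nu> = 0) \<and>
      mat_adjoint G * B * G = majorana_lincomb n d"
    using insert by auto
  obtain c where c: "mat_adjoint G * A * G = majorana_lincomb n c"
    using gaussian_unitary_conj_lincomb[OF G(1)] insert.prems(1) by auto
  obtain H where H: "gaussian_unitary n H"
    "\<And>d. (\<And>\<nu>. \<nu> \<in> {?N<..2 * n} \<Longrightarrow> d \<nu> = 0) \<Longrightarrow>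
      \<exists>d'. (\<forall>\<nu> \<in> {?N<..2 * n}. d' \<nu> = 0) \<and>
        mat_adjoint H * majorana_lincomb n d * H = majorana_lincomb n d'"
    "\<exists>c'. (\<forall>\<nu> \<in> {Suc ?N<..2 * n}. c' \<nu> = 0) \<and>
        mat_adjoint H * majorana_lincomb n c * H = majorana_lincomb n c'"
    using gaussian_unitary_householder[OF N(1), of c] by blast
  have GH: "G \<in> carrier_mat (2 ^ n) (2 ^ n)" "H \<in> carrier_mat (2 ^ n) (2 ^ n)"
    using G H by (simp_all add: gaussian_unitary_carrier)
  have conj: "mat_adjoint (G * H) * B * (G * H) = mat_adjoint H * (mat_adjoint G * B * G) * H"
    if "B \<in> insert A C" for B
  proof -
    have "B \<in> carrier_mat (2 ^ n) (2 ^ n)" using that insert.prems(1) by auto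
    then show ?thesis using GH
      by (simp add: mat_adjoint_mult[OF GH] assoc_mult_mat[of _ "2 ^ n" "2 ^ n" _ "2 ^ n" _ "2 ^ n"])
  qed
  have "\<exists>d. (\<forall>\<nu> \<in> {Suc ?N<..2 * n}. d \<nu> = 0) \<and> mat_adjoint (G * H) * B * (G * H) = majorana_lincomb n d"
    if B: "B \<in> insert A C" for B
  proof (cases "B = A")
    case True
    then show ?thesis unfolding conj[OF B] using c H(3) by simp
  next
    case False
    then obtain d where d: "\<forall>\<nu> \<in> {?N<..2 * n}. d \<nu> = 0" "mat_adjoint G * B * G = majorana_lincomb n d"
      using G(2)[of B] B by blast
    then obtain d' where "\<forall>\<nu> \<in> {?N<..2 * n}. d' \<nu> = 0"
      "mat_adjoint H * majorana_lincomb n d * H = majorana_lincomb n d'"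
      using H(2)[of d] by blast
    then show ?thesis unfolding conj[OF B] d(2) by (intro exI[of _ d']) auto
  qed
  then show ?case using gaussian_unitary_mult[OF G(1) H(1)] N(2) by auto
qed

subsection \<open>Doped Gaussian unitaries\<close>

lemma majorana_algebra_carrier:
  assumes "A \<in> majorana_algebra n S" "S \<subseteq> {1..2 * n}"
  shows "A \<in> carrier_mat (2 ^ n) (2 ^ n)"
  using assms by induction (auto intro: majorana_carrier dest: subsetD simp del: One_nat_def)

text \<open>The matrices commuting with B contain the identity and are closed under sums, scalar
  multiples and products.\<close>

lemma majorana_algebra_commute:
  assumes "A \<in> majorana_algebra n S" and S: "S \<subseteq> {1..2 * n}"
    and B: "B \<in> carrier_mat (2 ^ n) (2 ^ n)"
    and comm: "\<And>\<mu>. \<mu> \<in> S \<Longrightarrow> mat_commute (majorana n \<mu>) B"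
  shows "mat_commute A B"
  using assms(1)
proof induction
  case one
  then show ?case using B by (simp add: mat_commute_def)
next
  case (gen \<mu>)
  then show ?case by (rule comm)
next
  case (add A C)
  then have "A \<in> carrier_mat (2 ^ n) (2 ^ n)" "C \<in> carrier_mat (2 ^ n) (2 ^ n)"
    using S by (simp_all add: majorana_algebra_carrier)
  with add B show ?case
    by (simp add: mat_commute_def add_mult_distrib_mat mult_add_distrib_mat)
next
  case (smult A c)
  then have "A \<in> carrier_mat (2 ^ n) (2 ^ n)" using S by (simp add: majorana_algebra_carrier)
  with smult B show ?case
    by (simp add: mat_commute_def mult_smult_assoc_mat mult_smult_distrib)
next
  case (mult A C)
  then show ?case using S B by (intro mat_commute_mult) (simp_all add: majorana_algebra_carrier)
qed

text \<open>All that is retained of a gate besides its unitarity: a bounded set of generators whose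
  commutant it respects. The Hamiltonian disappears here.\<close>

lemma local_gate_commute:
  assumes "local_gate n \<kappa> W"
  obtains S where "S \<subseteq> {1..2 * n}" "card S \<le> \<kappa>"
    "\<And>B. B \<in> carrier_mat (2 ^ n) (2 ^ n) \<Longrightarrow> (\<And>\<mu>. \<mu> \<in> S \<Longrightarrow> mat_commute (majorana n \<mu>) B) \<Longrightarrow>
      mat_commute W B"
proof -
  obtain S H where S: "S \<subseteq> {1..2 * n}" "card S \<le> \<kappa>" and H: "H \<in> majorana_algebra n S"
    and W: "W = mat_exp (\<i> \<cdot>\<^sub>m H)"
    using assms unfolding local_gate_def by blast
  \<comment> \<open>The algebra is complex, so the exponent lies in it as well as H.\<close>
  have iH: "\<i> \<cdot>\<^sub>m H \<in> majorana_algebra n S" using H by (rule majorana_algebra.smult)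
  show ?thesis
  proof (rule that[OF S])
    fix B :: "complex mat"
    assume B: "B \<in> carrier_mat (2 ^ n) (2 ^ n)" "\<And>\<mu>. \<mu> \<in> S \<Longrightarrow> mat_commute (majorana n \<mu>) B"
    show "mat_commute W B"
      unfolding W using majorana_algebra_carrier[OF iH S(1)] B(1) majorana_algebra_commute[OF iH S(1) B]
      by (rule mat_commute_exp)
  qed
qed

text \<open>Moving every Gaussian factor to the right turns the gates into gates generated by rotated
  Majorana operators; \<open>C\<close> collects these, and \<open>M\<close> lies in their bicommutant.\<close>

lemma doped_product_decomposition:
  assumes "\<And>i. i \<le> s \<Longrightarrow> gaussian_unitary n (G i)"
    and "\<And>i. 1 \<le> i \<Longrightarrow> i \<le> s \<Longrightarrow> local_gate n \<kappa> (W i)"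
  shows "\<exists>M F C. doped_product G W s = M * F \<and> unitary_mat (2 ^ n) M \<and> gaussian_unitary n F \<and>
    finite C \<and> C \<subseteq> range (majorana_lincomb n) \<and> card C \<le> \<kappa> * s \<and>
    (\<forall>B \<in> carrier_mat (2 ^ n) (2 ^ n). (\<forall>A \<in> C. mat_commute A B) \<longrightarrow> mat_commute M B)"
  using assms
proof (induction s)
  case 0
  then have G: "gaussian_unitary n (G 0)" by simp
  then have "doped_product G W 0 = 1\<^sub>m (2 ^ n) * G 0"
    using left_mult_one_mat[OF gaussian_unitary_carrier] by simp
  then show ?case using G
    by (intro exI[of _ "1\<^sub>m (2 ^ n)"] exI[of _ "G 0"] exI[of _ "{}"])
      (auto simp: unitary_mat_one mat_commute_def)
next
  case (Suc s)
  let ?D = "(2 :: nat) ^ n"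
  obtain M F C where IH: "doped_product G W s = M * F" "unitary_mat ?D M" "gaussian_unitary n F"
    "finite C" "C \<subseteq> range (majorana_lincomb n)" "card C \<le> \<kappa> * s"
    and M: "\<And>B. B \<in> carrier_mat ?D ?D \<Longrightarrow> (\<And>A. A \<in> C \<Longrightarrow> mat_commute A B) \<Longrightarrow> mat_commute M B"
    using Suc.IH Suc.prems by auto
  define g where "g = G (Suc s)"
  have g: "gaussian_unitary n g" using Suc.prems by (simp add: g_def)
  then have gu: "unitary_mat ?D g" by (rule gaussian_unitary_unitary)
  have "local_gate n \<kappa> (W (Suc s))" using Suc.prems by simp
  then obtain S where S: "S \<subseteq> {1..2 * n}" "card S \<le> \<kappa>"
    and W: "\<And>B. B \<in> carrier_mat ?D ?D \<Longrightarrow> (\<And>\<mu>. \<mu> \<in> S \<Longrightarrow> mat_commute (majorana n \<mu>) B) \<Longrightarrow>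
      mat_commute (W (Suc s)) B"
    by (rule local_gate_commute) blast
  have Wu: "unitary_mat ?D (W (Suc s))" using Suc.prems by (simp add: local_gate_def)
  have c: "g \<in> carrier_mat ?D ?D" "W (Suc s) \<in> carrier_mat ?D ?D" "M \<in> carrier_mat ?D ?D"
    "F \<in> carrier_mat ?D ?D" "mat_adjoint g \<in> carrier_mat ?D ?D"
    using unitary_mat_carrier gu Wu IH(2) gaussian_unitary_carrier[OF IH(3)] by auto
  have "finite S" using S(1) by (rule finite_subset) simp
  \<comment> \<open>Unit coefficient vectors turn the new Majorana operators into combinations, so
    old and new generators are treated alike.\<close>
  have maj: "A \<in> range (majorana_lincomb n)" if A: "A \<in> C \<union> majorana n ` S" for A
  proof (cases "A \<in> C")
    case False
    then obtain \<mu> where "\<mu> \<in> S" "A = majorana n \<mu>" using A by auto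
    then show ?thesis using majorana_lincomb_unit[of \<mu> n] S(1) by (metis rangeI subsetD)
  qed (use IH(5) in auto)
  \<comment> \<open>The new Gaussian factor stands to the left of everything, so it rotates the old
    generators along with the new ones.\<close>
  define C' where "C' = (\<lambda>A. g * A * mat_adjoint g) ` (C \<union> majorana n ` S)"
  define M' where "M' = g * (W (Suc s) * M) * mat_adjoint g"
  have "doped_product G W (Suc s) = M' * (g * F)"
  proof -
    have "M' * (g * F) = g * (W (Suc s) * (M * (mat_adjoint g * (g * F))))"
      using c by (simp add: M'_def assoc_mult_mat[of _ ?D ?D _ ?D _ ?D])
    also have "mat_adjoint g * (g * F) = F"
      using gu by (intro mat_cancel_middle[OF c(4,5,1)]) (simp add: unitary_mat_def)
    finally show ?thesis
      using c by (simp add: IH(1) g_def[symmetric] assoc_mult_mat[of _ ?D ?D _ ?D _ ?D])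
  qed
  moreover have "unitary_mat ?D M'"
    unfolding M'_def using gu Wu IH(2) by (intro unitary_mat_mult unitary_mat_adjoint)
  moreover have "gaussian_unitary n (g * F)" using g IH(3) by (rule gaussian_unitary_mult)
  moreover have "finite C'" using IH(4) \<open>finite S\<close> by (simp add: C'_def)
  moreover have "C' \<subseteq> range (majorana_lincomb n)"
  proof
    fix A' assume "A' \<in> C'"
    then obtain A where A: "A \<in> C \<union> majorana n ` S" "A' = g * A * mat_adjoint g"
      by (auto simp: C'_def)
    then obtain d where "A = majorana_lincomb n d" using maj by blast
    then show "A' \<in> range (majorana_lincomb n)"
      using gaussian_unitary_conj_lincomb[OF gaussian_unitary_adjoint[OF g], of d] A(2) by auto
  qed
  moreover have "card C' \<le> \<kappa> * Suc s"
  proof -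
    have "card C' \<le> card (C \<union> majorana n ` S)"
      unfolding C'_def using IH(4) \<open>finite S\<close> by (intro card_image_le) simp
    also have "\<dots> \<le> card C + card (majorana n ` S)" by (rule card_Un_le)
    also have "\<dots> \<le> \<kappa> * s + \<kappa>"
      using IH(6) S(2) card_image_le[OF \<open>finite S\<close>, of "majorana n"] by linarith
    finally show ?thesis by simp
  qed
  moreover have "mat_commute M' B"
    if B: "B \<in> carrier_mat ?D ?D" and comm: "\<forall>A \<in> C'. mat_commute A B" for B
  proof -
    \<comment> \<open>B commutes with a rotated generator exactly when \<open>?B\<close> commutes
      with the original one, so the facts about W and M apply to \<open>?B\<close>.\<close>
    let ?B = "mat_adjoint g * B * g"
    have B': "?B \<in> carrier_mat ?D ?D" using B c by simp
    have "mat_commute A ?B" if A: "A \<in> C \<union> majorana n ` S" for A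
    proof -
      have "A \<in> carrier_mat ?D ?D" using maj[OF A] by auto
      from mat_commute_conj_shift[OF gu this B] show ?thesis
        using comm A by (auto simp: C'_def)
    qed
    then have "mat_commute (W (Suc s)) ?B" "mat_commute M ?B"
      using W[OF B'] M[OF B'] by auto
    then have "mat_commute (W (Suc s) * M) ?B"
      using c B' by (intro mat_commute_mult[of _ ?D]) auto
    moreover have "W (Suc s) * M \<in> carrier_mat ?D ?D" using c by simp
    ultimately show ?thesis
      unfolding M'_def using mat_commute_conj_shift[OF gu _ B] by blast
  qed
  ultimately show ?case by blast
qed

theorem theorem26:
  fixes n t \<kappa> :: nat and U :: "complex mat"
  assumes "0 < n" and "0 < t" and "0 < \<kappa>" and "\<kappa> * t \<le> n"
    and "doped_gaussian_unitary n t \<kappa> U"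
  shows "\<exists>G_A G_B u. gaussian_unitary n G_A \<and> gaussian_unitary n G_B \<and>
           unitary_mat (2 ^ nat \<lceil>real (\<kappa> * t) / 2\<rceil>) u \<and>
           U = G_A * kron u (1\<^sub>m (2 ^ (n - nat \<lceil>real (\<kappa> * t) / 2\<rceil>))) * G_B"
proof -
  define m where "m = nat \<lceil>real (\<kappa> * t) / 2\<rceil>"
  \<comment> \<open>Rounding up leaves room for all \<kappa> t compressed combinations among the
    first 2 m Majorana operators, and \<kappa> t \<le> n keeps m within n.\<close>
  have m: "\<kappa> * t \<le> 2 * m" "m \<le> n"
    using \<open>\<kappa> * t \<le> n\<close> unfolding m_def by linarith+
  let ?D = "(2 :: nat) ^ n" and ?d = "(2 :: nat) ^ m" and ?e = "(2 :: nat) ^ (n - m)"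
  have dim: "?D = ?d * ?e" using m(2) by (simp flip: power_add)
  obtain G W where "\<forall>i \<in> {0..t}. gaussian_unitary n (G i)" "\<forall>i \<in> {1..t}. local_gate n \<kappa> (W i)"
    and U: "U = doped_product G W t"
    using assms(5) unfolding doped_gaussian_unitary_def by blast
  then obtain M F C where MF: "U = M * F" "unitary_mat ?D M" "gaussian_unitary n F"
    and C: "finite C" "C \<subseteq> range (majorana_lincomb n)" "card C \<le> \<kappa> * t"
    and comm: "\<forall>B \<in> carrier_mat ?D ?D. (\<forall>A \<in> C. mat_commute A B) \<longrightarrow> mat_commute M B"
    using doped_product_decomposition[of t n G \<kappa> W] by auto
  obtain G where G: "gaussian_unitary n G"
    and compress: "\<And>A. A \<in> C \<Longrightarrow> \<exists>d. (\<forall>\<nu> \<in> {card C<..2 * n}. d \<nu> = 0) \<and>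
      mat_adjoint G * A * G = majorana_lincomb n d"
    using gaussian_unitary_compress[OF C(1,2)] C(3) \<open>\<kappa> * t \<le> n\<close> by auto
  have Gu: "unitary_mat ?D G" "unitary_mat ?D (mat_adjoint G)"
    using G by (simp_all add: gaussian_unitary_unitary unitary_mat_adjoint)
  have c: "G \<in> carrier_mat ?D ?D" "mat_adjoint G \<in> carrier_mat ?D ?D" "M \<in> carrier_mat ?D ?D"
    "F \<in> carrier_mat ?D ?D"
    using Gu MF by (auto simp: unitary_mat_carrier gaussian_unitary_carrier)
  define M' where "M' = mat_adjoint G * M * G"
  have M'u: "unitary_mat ?D M'"
    unfolding M'_def using Gu MF by (intro unitary_mat_mult)
  have "mat_commute M' (kron (1\<^sub>m ?d) P)" if P: "P \<in> carrier_mat ?e ?e" for P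
  proof -
    let ?P = "kron (1\<^sub>m ?d) P"
    have P': "?P \<in> carrier_mat ?D ?D" unfolding dim using P by simp
    have P_G: "G * ?P * mat_adjoint G \<in> carrier_mat ?D ?D" using c P' by simp
    \<comment> \<open>M is controlled only through the commutant of C, so \<open>?P\<close> is
      rotated back by G and tested against the uncompressed generators.\<close>
    have "mat_commute A (G * ?P * mat_adjoint G)" if A: "A \<in> C" for A
    proof -
      obtain d where d: "\<And>\<nu>. \<nu> \<in> {card C<..2 * n} \<Longrightarrow> d \<nu> = 0"
        "mat_adjoint G * A * G = majorana_lincomb n d"
        using compress[OF A] by blast
      have "mat_commute (majorana_lincomb n d) ?P"
      proof (rule mat_commute_majorana_lincomb[OF P'])
        \<comment> \<open>A nonzero coefficient forces \<nu> \<le> card C \<le> \<kappa> t \<le> 2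
          m, hence an operator on the first m qubits.\<close>
        fix \<nu> assume "\<nu> \<in> {1..2 * n}" "d \<nu> \<noteq> 0"
        moreover from this have "\<not> card C < \<nu>" using d(1)[of \<nu>] by auto
        ultimately have "\<nu> \<in> {1..2 * m}" using C(3) m(1) by auto
        from majorana_first_qubits[OF this m(2)] kron_commute[OF _ P]
        show "mat_commute (majorana n \<nu>) ?P" by auto
      qed
      moreover have "A \<in> carrier_mat ?D ?D" using A C(2) by auto
      ultimately show ?thesis
        using mat_commute_conj_shift[OF Gu(2) _ P', of A] mat_commute_conj[OF Gu(1) _ P_G, of A]
          d(2) P' by (simp add: unitary_conj_cancel[OF Gu(1)])
    qed
    then have "mat_commute M (G * ?P * mat_adjoint G)" using comm P_G by blast
    then show ?thesis
      using mat_commute_conj[OF Gu(1) c(3) P_G] P' by (simp add: M'_def unitary_conj_cancel[OF Gu(1)])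
  qed
  moreover have "M' \<in> carrier_mat (?d * ?e) (?d * ?e)"
    using unitary_mat_carrier[OF M'u] by (simp only: dim)
  ultimately obtain u where u: "u \<in> carrier_mat ?d ?d" "M' = kron u (1\<^sub>m ?e)"
    using commutant_of_kron_one[of M' ?d ?e] by auto
  have "unitary_mat ?d u"
    using unitary_mat_kron_one[of ?d ?e u] M'u u by (simp add: dim)
  \<comment> \<open>M is the conjugate of M' back by G, and the adjoint of G left on the right
    merges with F into the second Gaussian factor.\<close>
  moreover have "U = G * kron u (1\<^sub>m ?e) * (mat_adjoint G * F)"
  proof -
    have "M = G * M' * mat_adjoint G" unfolding M'_def by (simp add: unitary_conj_cancel[OF Gu(1) c(3)])
    then show ?thesis
      using c unitary_mat_carrier[OF M'u] MF(1)
      by (simp add: u(2)[symmetric] assoc_mult_mat[of _ ?D ?D _ ?D _ ?D])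
  qed
  moreover have "gaussian_unitary n (mat_adjoint G * F)"
    using G MF(3) by (intro gaussian_unitary_mult gaussian_unitary_adjoint)
  ultimately show ?thesis using G unfolding m_def by blast
qed

end
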